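(* Let $c$ be a positive integer and $\mu,\nu\in\mathbb{R}$. For every projection $P$ ($P=P^2=P^*$) in the smooth algebra $(D^c_{\mu\nu})^\infty$, \[ S(P)\ \ge\ |c_{XY}(P)|+|c_{YZ}(P)|+|c_{XZ}(P)|\ \ge\ |c_\nabla(P)|, \] where \[ S(P)=2\,\tau_D\big((\delta_XP)^2+(\delta_YP)^2+(\delta_ZP)^2\big), \] \[ c_{VW}(P)=\frac{1}{2\pi i}\,\tau_D\big(P(\delta_VP\,\delta_WP-\delta_WP\,\delta_VP)\big)\quad(V,W\in\mathfrak{h}), \] and $c_\nabla(P)=c_{XY}(P)+c_{XZ}(P)+c_{YZ}(P)$ is the topological charge of $P$.
   Context: Notation: $\mathbb{T}=\mathbb{R}/\mathbb{Z}$, $M=\mathbb{R}\times\mathbb{T}$, $e(t)=\exp(2\pi it)$. Quantum Heisenberg manifold: $D_0$ is the set of bounded continuous functions $\Phi$ on $M\times\mathbb{Z}$ with compact support in the $\mathbb{Z}$-variable satisfying $\overline{e}(ckp(y-p\nu))\Phi(x+k,y,p)=\Phi(x,y,p)$ for all $k\in\mathbb{Z}$, with product $(\Phi*\Psi)(x,y,p)=\sum_{q}\Phi(x,y,q)\Psi(x-2q\mu,y-2q\nu,p-q)$ and involution $\Phi^*(x,y,p)=\overline{\Phi}(x-2p\mu,y-2p\nu,-p)$. $D^c_{\mu\nu}$ is the closure of $D_0$ in the multiplier algebra of the crossed product $C_b(M)\rtimes_\lambda\mathbb{Z}$, $\lambda_p(x,y)=(x+2p\mu,y+2p\nu)$.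 Heisenberg action: $H$ is $\mathbb{R}^3$ with product $(x,y,z)(x',y',z')=(x+x',y+y',z+z'+cyx')$; it acts on $D^c_{\mu\nu}$ by $(L_{(r,s,t)}\Phi)(x,y,p)=e(p(t+cs(x-r-p\mu)))\Phi(x-r,y-s,p)$. $(D^c_{\mu\nu})^\infty$ is the subalgebra of elements $\Phi$ for which $h\mapsto L_h(\Phi)$ is smooth in norm. The Lie algebra $\mathfrak{h}$ has basis $X=(0,1,0)$, $Y=(1,0,0)$, $Z=(0,0,1)$ with $[X,Y]=cZ$ and $Z$ central, and the infinitesimal action (extended linearly to $\mathfrak{h}$) is \[ \delta_X\Phi=2\pi icp(x-p\mu)\Phi-\partial_y\Phi,\quad \delta_Y\Phi=-\partial_x\Phi,\quad\delta_Z\Phi=2\pi ip\,\Phi . \] Trace: $\tau_D(\Phi)=\int_{\mathbb{T}^2}\Phi(x,y,0)\,dx\,dy$, a faithful $L$-invariant trace on $D^c_{\mu\nu}$. The subscript $\nabla$ in $c_\nabla(P)$ is only notation; the definition involves no connection. *)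

theory Defs
  imports "HOL-Analysis.Analysis" "HOL-Library.Function_Algebras"
begin

text \<open>
  A function on \<open>M \<times> \<int>\<close>, where \<open>M = \<real> \<times> \<real>/\<int>\<close>, is a curried function \<open>\<Phi> x y p\<close> that is
  \<open>1\<close>-periodic in \<open>y\<close>. Elements of the crossed product of \<open>C\<^sub>b(M)\<close> by \<open>\<int>\<close> are identified with
  their coefficient functions on \<open>M \<times> \<int>\<close>. The linear structure of these
  functions is the pointwise one; the multiplication is \<open>cp_prod\<close>, not the pointwise product.
\<close>

type_synonym cfun = "real \<Rightarrow> real \<Rightarrow> int \<Rightarrow> complex"

definition ex :: "real \<Rightarrow> complex" where
  "ex t = exp (2 * of_real pi * \<i> * of_real t)"

definition cscale :: "complex \<Rightarrow> cfun \<Rightarrow> cfun" where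
  "cscale a \<Phi> = (\<lambda>x y p. a * \<Phi> x y p)"

text \<open>
  The sum below is finite for coefficient functions of finite support in \<open>p\<close>, and absolutely
  convergent (Cauchy-Schwarz) for all elements of the crossed product.
\<close>

definition cp_prod :: "real \<Rightarrow> real \<Rightarrow> cfun \<Rightarrow> cfun \<Rightarrow> cfun" where
  "cp_prod \<mu> \<nu> \<Phi> \<Psi> = (\<lambda>x y p. \<Sum>\<^sub>\<infinity>q\<in>UNIV.
     \<Phi> x y q * \<Psi> (x - 2 * of_int q * \<mu>) (y - 2 * of_int q * \<nu>) (p - q))"

definition cp_star :: "real \<Rightarrow> real \<Rightarrow> cfun \<Rightarrow> cfun" where
  "cp_star \<mu> \<nu> \<Phi> = (\<lambda>x y p. cnj (\<Phi> (x - 2 * of_int p * \<mu>) (y - 2 * of_int p * \<nu>) (- p)))"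


subsection \<open>The crossed product and its norm\<close>

definition l2 :: "(int \<Rightarrow> complex) set" where
  "l2 = {\<xi>. (\<lambda>p. (cmod (\<xi> p))\<^sup>2) summable_on UNIV}"

definition l2_norm :: "(int \<Rightarrow> complex) \<Rightarrow> real" where
  "l2_norm \<xi> = sqrt (\<Sum>\<^sub>\<infinity>p\<in>UNIV. (cmod (\<xi> p))\<^sup>2)"

text \<open>
  The regular representation on \<open>\<ell>\<^sup>2(\<int>)\<close> over the point \<open>m = (x, y)\<close>: it is induced by evaluation
  at \<open>m\<close>, so \<open>f \<in> C\<^sub>b(M)\<close> acts by \<open>(f \<xi>)(p) = f(\<lambda>\<^sub>p m) \<xi>(p)\<close>, and the unitary implementing
  \<open>q \<in> \<int>\<close> by \<open>(u\<^sub>q \<xi>)(p) = \<xi>(p - q)\<close>.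
\<close>

definition reg_rep :: "real \<Rightarrow> real \<Rightarrow> cfun \<Rightarrow> real \<Rightarrow> real \<Rightarrow> (int \<Rightarrow> complex) \<Rightarrow> int \<Rightarrow> complex" where
  "reg_rep \<mu> \<nu> \<Phi> x y \<xi> = (\<lambda>p. \<Sum>\<^sub>\<infinity>q\<in>UNIV.
     \<Phi> (x + 2 * of_int p * \<mu>) (y + 2 * of_int p * \<nu>) q * \<xi> (p - q))"

definition reg_bound :: "real \<Rightarrow> real \<Rightarrow> cfun \<Rightarrow> real \<Rightarrow> bool" where
  "reg_bound \<mu> \<nu> \<Phi> C \<longleftrightarrow> C \<ge> 0 \<and> (\<forall>x y. \<forall>\<xi>\<in>l2.
     (\<forall>p. (\<lambda>q. \<Phi> (x + 2 * of_int p * \<mu>) (y + 2 * of_int p * \<nu>) q * \<xi> (p - q)) summable_on UNIV) \<and>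
     reg_rep \<mu> \<nu> \<Phi> x y \<xi> \<in> l2 \<and> l2_norm (reg_rep \<mu> \<nu> \<Phi> x y \<xi>) \<le> C * l2_norm \<xi>)"

definition reg_bounded :: "real \<Rightarrow> real \<Rightarrow> cfun set" where
  "reg_bounded \<mu> \<nu> = {\<Phi>. \<exists>C. reg_bound \<mu> \<nu> \<Phi> C}"

text \<open>
  The operator norm of the direct sum of the regular representations over all points of \<open>M\<close>.
  Evaluations at points are jointly faithful on \<open>C\<^sub>b(M)\<close> and \<open>\<int>\<close> is amenable, so on functions of
  finite support this is the (full and reduced) \<open>C\<^sup>*\<close>-norm of the crossed product. It dominates
  every coefficient pointwise, hence the completion can be formed inside the functions on
  \<open>M \<times> \<int>\<close>. Meaningful on \<open>reg_bounded\<close> only.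
\<close>

definition cp_norm :: "real \<Rightarrow> real \<Rightarrow> cfun \<Rightarrow> real" where
  "cp_norm \<mu> \<nu> \<Phi> = Inf {C. reg_bound \<mu> \<nu> \<Phi> C}"

definition cp_closure :: "real \<Rightarrow> real \<Rightarrow> cfun set \<Rightarrow> cfun set" where
  "cp_closure \<mu> \<nu> A = {\<Phi> \<in> reg_bounded \<mu> \<nu>.
     \<forall>\<epsilon>>0. \<exists>\<Psi>\<in>A. \<Phi> - \<Psi> \<in> reg_bounded \<mu> \<nu> \<and> cp_norm \<mu> \<nu> (\<Phi> - \<Psi>) < \<epsilon>}"

text \<open>Finitely supported functions from \<open>\<int>\<close> to \<open>C\<^sub>b(M)\<close>.\<close>

definition Cc_Z_CbM :: "cfun set" where
  "Cc_Z_CbM = {\<Phi>.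
     (\<forall>x y p. \<Phi> x (y + 1) p = \<Phi> x y p) \<and>
     (\<forall>p. continuous_on UNIV (\<lambda>(x, y). \<Phi> x y p)) \<and>
     (\<exists>B. \<forall>x y p. cmod (\<Phi> x y p) \<le> B) \<and>
     (\<exists>F. finite F \<and> (\<forall>x y p. p \<notin> F \<longrightarrow> \<Phi> x y p = 0))}"

definition crossed_product :: "real \<Rightarrow> real \<Rightarrow> cfun set" where
  "crossed_product \<mu> \<nu> = cp_closure \<mu> \<nu> Cc_Z_CbM"


subsection \<open>The quantum Heisenberg manifold\<close>

definition D0 :: "nat \<Rightarrow> real \<Rightarrow> cfun set" where
  "D0 c \<nu> = {\<Phi> \<in> Cc_Z_CbM. \<forall>(k::int) x y p.
     cnj (ex (of_nat c * of_int k * of_int p * (y - of_int p * \<nu>))) * \<Phi> (x + of_int k) y p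
       = \<Phi> x y p}"

text \<open>
  The crossed product of the unital algebra \<open>C\<^sub>b(M)\<close> by \<open>\<int>\<close> is unital, so it is its own
  multiplier algebra.
\<close>

definition QHM :: "nat \<Rightarrow> real \<Rightarrow> real \<Rightarrow> cfun set" where
  "QHM c \<mu> \<nu> = crossed_product \<mu> \<nu> \<inter> cp_closure \<mu> \<nu> (D0 c \<nu>)"

text \<open>
  The action of the Heisenberg group, whose underlying manifold is \<open>\<real>\<^sup>3\<close>.
\<close>

definition heis_act :: "nat \<Rightarrow> real \<Rightarrow> real \<times> real \<times> real \<Rightarrow> cfun \<Rightarrow> cfun" where
  "heis_act c \<mu> = (\<lambda>(r, s, t) \<Phi> x y p.
     ex (of_int p * (t + of_nat c * s * (x - r - of_int p * \<mu>))) * \<Phi> (x - r) (y - s) p)"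

text \<open>
  Norm-\<open>C\<^sup>n\<close> maps from \<open>\<real>\<^sup>3\<close> to the Banach space \<open>QHM c \<mu> \<nu>\<close>, by iterated partial derivatives:
  \<open>Basis\<close> consists of the three coordinate vectors.
\<close>

definition QHM_continuous :: "nat \<Rightarrow> real \<Rightarrow> real \<Rightarrow> (real \<times> real \<times> real \<Rightarrow> cfun) \<Rightarrow> bool" where
  "QHM_continuous c \<mu> \<nu> F \<longleftrightarrow> (\<forall>h. F h \<in> QHM c \<mu> \<nu>) \<and>
     (\<forall>h. ((\<lambda>h'. cp_norm \<mu> \<nu> (F h' - F h)) \<longlongrightarrow> 0) (at h))"

definition QHM_partial ::
    "real \<Rightarrow> real \<Rightarrow> real \<times> real \<times> real \<Rightarrow> (real \<times> real \<times> real \<Rightarrow> cfun) \<Rightarrow>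
     (real \<times> real \<times> real \<Rightarrow> cfun) \<Rightarrow> bool" where
  "QHM_partial \<mu> \<nu> b F G \<longleftrightarrow> (\<forall>h.
     ((\<lambda>u::real. cp_norm \<mu> \<nu> (cscale (of_real (1 / u)) (F (h + u *\<^sub>R b) - F h) - G h)) \<longlongrightarrow> 0) (at 0))"

primrec QHM_Cn ::
    "nat \<Rightarrow> real \<Rightarrow> real \<Rightarrow> nat \<Rightarrow> (real \<times> real \<times> real \<Rightarrow> cfun) \<Rightarrow> bool" where
  "QHM_Cn c \<mu> \<nu> 0 F \<longleftrightarrow> QHM_continuous c \<mu> \<nu> F"
| "QHM_Cn c \<mu> \<nu> (Suc n) F \<longleftrightarrow> QHM_continuous c \<mu> \<nu> F \<and>
     (\<forall>b\<in>Basis. \<exists>G. QHM_partial \<mu> \<nu> b F G \<and> QHM_Cn c \<mu> \<nu> n G)"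

definition QHM_smooth :: "nat \<Rightarrow> real \<Rightarrow> real \<Rightarrow> cfun set" where
  "QHM_smooth c \<mu> \<nu> = {\<Phi> \<in> QHM c \<mu> \<nu>. \<forall>n. QHM_Cn c \<mu> \<nu> n (\<lambda>h. heis_act c \<mu> h \<Phi>)}"


subsection \<open>Infinitesimal action, trace, and the functionals\<close>

text \<open>
  The Heisenberg Lie algebra, with underlying vector space \<open>\<real>\<^sup>3\<close>. Mind the order of \<open>X\<close> and \<open>Y\<close>.
\<close>

type_synonym heis_lie = "real \<times> real \<times> real"

definition hX :: heis_lie where "hX = (0, 1, 0)"
definition hY :: heis_lie where "hY = (1, 0, 0)"
definition hZ :: heis_lie where "hZ = (0, 0, 1)"

definition deltaX :: "nat \<Rightarrow> real \<Rightarrow> cfun \<Rightarrow> cfun" where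
  "deltaX c \<mu> \<Phi> = (\<lambda>x y p.
     2 * of_real pi * \<i> * of_nat c * of_int p * of_real (x - of_int p * \<mu>) * \<Phi> x y p
       - vector_derivative (\<lambda>y'. \<Phi> x y' p) (at y))"

definition deltaY :: "cfun \<Rightarrow> cfun" where
  "deltaY \<Phi> = (\<lambda>x y p. - vector_derivative (\<lambda>x'. \<Phi> x' y p) (at x))"

definition deltaZ :: "cfun \<Rightarrow> cfun" where
  "deltaZ \<Phi> = (\<lambda>x y p. 2 * of_real pi * \<i> * of_int p * \<Phi> x y p)"

text \<open>The linear extension: \<open>(a, b, d) = b X + a Y + d Z\<close>.\<close>

definition delta :: "nat \<Rightarrow> real \<Rightarrow> heis_lie \<Rightarrow> cfun \<Rightarrow> cfun" where
  "delta c \<mu> = (\<lambda>(a, b, d) \<Phi>.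
     cscale (of_real b) (deltaX c \<mu> \<Phi>) + cscale (of_real a) (deltaY \<Phi>)
       + cscale (of_real d) (deltaZ \<Phi>))"

text \<open>
  For \<open>\<Phi> \<in> QHM c \<mu> \<nu>\<close> the coefficient at \<open>0\<close> is \<open>\<int>\<^sup>2\<close>-periodic and continuous; the torus is
  represented by the unit square.
\<close>

definition tauD :: "cfun \<Rightarrow> complex" where
  "tauD \<Phi> = integral (cbox (0, 0) (1, 1)) (\<lambda>(x, y). \<Phi> x y 0)"

definition action_S :: "nat \<Rightarrow> real \<Rightarrow> real \<Rightarrow> cfun \<Rightarrow> complex" where
  "action_S c \<mu> \<nu> P = 2 * tauD
     (cp_prod \<mu> \<nu> (delta c \<mu> hX P) (delta c \<mu> hX P)
      + cp_prod \<mu> \<nu> (delta c \<mu> hY P) (delta c \<mu> hY P)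
      + cp_prod \<mu> \<nu> (delta c \<mu> hZ P) (delta c \<mu> hZ P))"

definition charge2 :: "nat \<Rightarrow> real \<Rightarrow> real \<Rightarrow> heis_lie \<Rightarrow> heis_lie \<Rightarrow> cfun \<Rightarrow> complex" where
  "charge2 c \<mu> \<nu> V W P = 1 / (2 * of_real pi * \<i>) * tauD (cp_prod \<mu> \<nu> P
     (cp_prod \<mu> \<nu> (delta c \<mu> V P) (delta c \<mu> W P)
      - cp_prod \<mu> \<nu> (delta c \<mu> W P) (delta c \<mu> V P)))"

definition top_charge :: "nat \<Rightarrow> real \<Rightarrow> real \<Rightarrow> cfun \<Rightarrow> complex" where
  "top_charge c \<mu> \<nu> P =
     charge2 c \<mu> \<nu> hX hY P + charge2 c \<mu> \<nu> hX hZ P + charge2 c \<mu> \<nu> hY hZ P"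

definition QHM_projection :: "real \<Rightarrow> real \<Rightarrow> cfun \<Rightarrow> bool" where
  "QHM_projection \<mu> \<nu> P \<longleftrightarrow> cp_prod \<mu> \<nu> P P = P \<and> cp_star \<mu> \<nu> P = P"

end

theory Submission
  imports Defs
begin

text \<open>
  Write \<open>\<parallel>A\<parallel>\<^sup>2 = \<tau>\<^sub>D(A\<^sup>* A)\<close>. If \<open>A = \<delta>\<^sub>V P\<close> and \<open>B = \<delta>\<^sub>W P\<close>, then \<open>A\<close> and \<open>B\<close> are self-adjoint, so
  \<open>\<tau>\<^sub>D(P(AB - BA)) = \<langle>AP, B\<rangle> - \<langle>BP, A\<rangle>\<close>, and by the trace property
  \<open>\<parallel>AP\<parallel> = \<parallel>PA\<parallel> \<le> \<parallel>A\<parallel>\<close>. Cauchy-Schwarz bounds this by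
  \<open>2 \<parallel>A\<parallel> \<parallel>B\<parallel> \<le> \<parallel>A\<parallel>\<^sup>2 + \<parallel>B\<parallel>\<^sup>2\<close>, whence \<open>2\<pi> |c\<^sub>V\<^sub>W(P)| \<le> \<parallel>A\<parallel>\<^sup>2 + \<parallel>B\<parallel>\<^sup>2\<close>; the sum over the three pairs is at most
  \<open>S(P)\<close>. All this takes place fibrewise over the points \<open>m\<close> of the torus, where \<open>\<Phi>\<close> acts on \<open>\<ell>\<^sup>2(\<int>)\<close> by
  the matrix \<open>reg_mat\<close>, and \<open>\<tau>\<^sub>D(\<Phi>)\<close> is the integral over \<open>m\<close> of its \<open>(0, 0)\<close> entry.
\<close>

section \<open>Hermitian matrices on \<open>\<ell>\<^sup>2(\<int>)\<close>\<close>

lemma has_sum_diff: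
  fixes f g :: "'a \<Rightarrow> 'b::topological_ab_group_add"
  assumes "(f has_sum a) A" "(g has_sum b) A"
  shows "((\<lambda>x. f x - g x) has_sum (a - b)) A"
proof -
  have "((\<lambda>x. - g x) has_sum - b) A"
    using assms(2) by (simp add: has_sum_uminus)
  from has_sum_add[OF assms(1) this] show ?thesis by simp
qed

lemma has_sum_sum:
  fixes f :: "'i \<Rightarrow> 'a \<Rightarrow> 'b::topological_comm_monoid_add"
  assumes "\<And>i. i \<in> I \<Longrightarrow> (f i has_sum s i) A"
  shows "((\<lambda>x. \<Sum>i\<in>I. f i x) has_sum (\<Sum>i\<in>I. s i)) A"
  using assms by (induction I rule: infinite_finite_induct) (auto intro!: has_sum_add)

section \<open>Square-summable sequences and their inner product\<close>

definition l2_inner :: "(int \<Rightarrow> complex) \<Rightarrow> (int \<Rightarrow> complex) \<Rightarrow> complex" where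
  "l2_inner \<xi> \<eta> = (\<Sum>\<^sub>\<infinity>p\<in>UNIV. cnj (\<xi> p) * \<eta> p)"

lemma l2_norm_nonneg: "l2_norm \<xi> \<ge> 0"
  by (simp add: l2_norm_def infsum_nonneg)

lemma l2_norm_power2: "(l2_norm \<xi>)\<^sup>2 = (\<Sum>\<^sub>\<infinity>p\<in>UNIV. (cmod (\<xi> p))\<^sup>2)"
  by (simp add: l2_norm_def infsum_nonneg)

lemma l2_summable: "\<xi> \<in> l2 \<Longrightarrow> (\<lambda>p. (cmod (\<xi> p))\<^sup>2) summable_on UNIV"
  by (simp add: l2_def)

lemma L2_set_le_l2_norm:
  assumes "\<xi> \<in> l2" "finite F"
  shows "L2_set (\<lambda>p. cmod (\<xi> p)) F \<le> l2_norm \<xi>"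
  unfolding L2_set_def l2_norm_def
  using finite_sum_le_infsum[OF l2_summable[OF assms(1)] assms(2)] by simp

lemma cmod_le_l2_norm:
  assumes "\<xi> \<in> l2"
  shows "cmod (\<xi> p) \<le> l2_norm \<xi>"
  using L2_set_le_l2_norm[OF assms, of "{p}"] by (simp add: L2_set_def)

lemma l2_mult_sum_le:
  assumes "\<xi> \<in> l2" "\<eta> \<in> l2" "finite F"
  shows "(\<Sum>p\<in>F. cmod (\<xi> p) * cmod (\<eta> p)) \<le> l2_norm \<xi> * l2_norm \<eta>"
proof -
  have "(\<Sum>p\<in>F. cmod (\<xi> p) * cmod (\<eta> p))
      \<le> L2_set (\<lambda>p. cmod (\<xi> p)) F * L2_set (\<lambda>p. cmod (\<eta> p)) F"
    using L2_set_mult_ineq[of "\<lambda>p. cmod (\<xi> p)" "\<lambda>p. cmod (\<eta> p)" F] by simp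
  also have "\<dots> \<le> l2_norm \<xi> * l2_norm \<eta>"
    using assms by (intro mult_mono L2_set_le_l2_norm l2_norm_nonneg L2_set_nonneg)
  finally show ?thesis .
qed

lemma l2_inner_abs_summable:
  assumes "\<xi> \<in> l2" "\<eta> \<in> l2"
  shows "(\<lambda>p. norm (cnj (\<xi> p) * \<eta> p)) summable_on UNIV"
  by (rule nonneg_bdd_above_summable_on)
    (auto intro!: bdd_aboveI2[where M = "l2_norm \<xi> * l2_norm \<eta>"] l2_mult_sum_le assms
      simp: norm_mult)

lemma l2_inner_summable:
  assumes "\<xi> \<in> l2" "\<eta> \<in> l2"
  shows "(\<lambda>p. cnj (\<xi> p) * \<eta> p) summable_on UNIV"
  by (rule Infinite_Sum.abs_summable_summable[OF l2_inner_abs_summable[OF assms]])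

lemma cmod_l2_inner_le:
  assumes "\<xi> \<in> l2" "\<eta> \<in> l2"
  shows "cmod (l2_inner \<xi> \<eta>) \<le> l2_norm \<xi> * l2_norm \<eta>"
proof -
  have "cmod (l2_inner \<xi> \<eta>) \<le> (\<Sum>\<^sub>\<infinity>p\<in>UNIV. cmod (cnj (\<xi> p) * \<eta> p))"
    unfolding l2_inner_def by (rule norm_infsum_bound[OF l2_inner_abs_summable[OF assms]])
  also have "\<dots> \<le> l2_norm \<xi> * l2_norm \<eta>"
    by (rule infsum_le_finite_sums[OF l2_inner_abs_summable[OF assms]])
      (auto simp: norm_mult intro!: l2_mult_sum_le assms)
  finally show ?thesis .
qed

lemma l2_inner_self:
  assumes "\<xi> \<in> l2"
  shows "l2_inner \<xi> \<xi> = of_real ((l2_norm \<xi>)\<^sup>2)"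
proof -
  have "((\<lambda>p. of_real ((cmod (\<xi> p))\<^sup>2) :: complex) has_sum of_real ((l2_norm \<xi>)\<^sup>2)) UNIV"
    unfolding l2_norm_power2
    by (rule has_sum_of_real[OF has_sum_infsum[OF l2_summable[OF assms]]])
  then have "((\<lambda>p. cnj (\<xi> p) * \<xi> p) has_sum of_real ((l2_norm \<xi>)\<^sup>2)) UNIV"
    by (simp only: complex_norm_square mult.commute)
  then show ?thesis
    unfolding l2_inner_def by (rule infsumI)
qed

text \<open>The elementary bound \<open>|a - b|^2 <= 2|a|^2 + 2|b|^2\<close> is summed over
  \<open>p\<close>. It takes the place of Minkowski's inequality, because later on only some finite
  bound for a difference is wanted.\<close>

lemma
  assumes "\<xi> \<in> l2" "\<eta> \<in> l2"
  shows l2_diff: "(\<lambda>p. \<xi> p - \<eta> p) \<in> l2"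
    and l2_norm_diff_le: "(l2_norm (\<lambda>p. \<xi> p - \<eta> p))\<^sup>2 \<le> 2 * (l2_norm \<xi>)\<^sup>2 + 2 * (l2_norm \<eta>)\<^sup>2"
proof -
  have le: "(cmod (\<xi> p - \<eta> p))\<^sup>2 \<le> 2 * (cmod (\<xi> p))\<^sup>2 + 2 * (cmod (\<eta> p))\<^sup>2" for p
  proof -
    have "(cmod (\<xi> p - \<eta> p))\<^sup>2 \<le> (cmod (\<xi> p) + cmod (\<eta> p))\<^sup>2"
      by (intro power_mono norm_triangle_ineq4) auto
    also have "\<dots> \<le> 2 * (cmod (\<xi> p))\<^sup>2 + 2 * (cmod (\<eta> p))\<^sup>2"
      using sum_squares_bound[of "cmod (\<xi> p)" "cmod (\<eta> p)"] by (simp add: power2_sum)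
    finally show ?thesis .
  qed
  have s: "(\<lambda>p. 2 * (cmod (\<xi> p))\<^sup>2) summable_on UNIV" "(\<lambda>p. 2 * (cmod (\<eta> p))\<^sup>2) summable_on UNIV"
    by (intro summable_on_cmult_right l2_summable assms)+
  have s2: "(\<lambda>p. 2 * (cmod (\<xi> p))\<^sup>2 + 2 * (cmod (\<eta> p))\<^sup>2) summable_on UNIV"
    by (intro summable_on_add s)
  show 1: "(\<lambda>p. \<xi> p - \<eta> p) \<in> l2"
    unfolding l2_def using summable_on_comparison_test[OF s2 le] by simp
  have "(l2_norm (\<lambda>p. \<xi> p - \<eta> p))\<^sup>2 \<le> (\<Sum>\<^sub>\<infinity>p\<in>UNIV. 2 * (cmod (\<xi> p))\<^sup>2 + 2 * (cmod (\<eta> p))\<^sup>2)"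
    unfolding l2_norm_power2 by (rule infsum_mono[OF l2_summable[OF 1] s2 le])
  also have "\<dots> = 2 * (l2_norm \<xi>)\<^sup>2 + 2 * (l2_norm \<eta>)\<^sup>2"
    by (simp add: infsum_add[OF s] l2_norm_power2 infsum_cmult_right')
  finally show "(l2_norm (\<lambda>p. \<xi> p - \<eta> p))\<^sup>2 \<le> 2 * (l2_norm \<xi>)\<^sup>2 + 2 * (l2_norm \<eta>)\<^sup>2" .
qed

lemma l2_cmult: "\<xi> \<in> l2 \<Longrightarrow> (\<lambda>p. a * \<xi> p) \<in> l2"
  by (auto simp: l2_def norm_mult power_mult_distrib intro: summable_on_cmult_right)

lemma l2_norm_cmult: "l2_norm (\<lambda>p. a * \<xi> p) = cmod a * l2_norm \<xi>"
  by (simp add: l2_norm_def norm_mult power_mult_distrib infsum_cmult_right' real_sqrt_mult)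

section \<open>Truncations and operators given by infinite matrices\<close>

definition restr :: "int set \<Rightarrow> (int \<Rightarrow> complex) \<Rightarrow> int \<Rightarrow> complex" where
  "restr F \<xi> p = (if p \<in> F then \<xi> p else 0)"

lemma restr_l2:
  assumes "\<xi> \<in> l2"
  shows "restr F \<xi> \<in> l2"
  unfolding l2_def restr_def
  by (auto intro!: summable_on_comparison_test[OF l2_summable[OF assms]])

text \<open>The squared norm of the tail is the full sum minus the partial sum over
  \<open>F\<close>, so this is convergence of the partial sums followed by continuity of the square
  root.\<close>

lemma tendsto_l2_norm_restr:
  assumes "\<xi> \<in> l2"
  shows "((\<lambda>F. l2_norm (\<lambda>p. \<xi> p - restr F \<xi> p)) \<longlongrightarrow> 0) (finite_subsets_at_top UNIV)"
proof -
  let ?f = "\<lambda>p. (cmod (\<xi> p))\<^sup>2"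
  have s: "?f summable_on UNIV" by (rule l2_summable[OF assms])
  have eq: "(\<Sum>\<^sub>\<infinity>p\<in>UNIV. (cmod (\<xi> p - restr F \<xi> p))\<^sup>2) = infsum ?f UNIV - sum ?f F" if "finite F" for F
  proof -
    have "((\<lambda>p. if p \<in> F then ?f p else 0) has_sum sum ?f F) UNIV"
      using that by (intro has_sum_finite_neutralI[where B = F]) auto
    then have "((\<lambda>p. ?f p - (if p \<in> F then ?f p else 0)) has_sum (infsum ?f UNIV - sum ?f F)) UNIV"
      by (intro has_sum_diff has_sum_infsum s)
    then have "((\<lambda>p. (cmod (\<xi> p - restr F \<xi> p))\<^sup>2) has_sum (infsum ?f UNIV - sum ?f F)) UNIV"
      by (rule has_sum_cong[THEN iffD1, rotated]) (auto simp: restr_def)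
    then show ?thesis by (rule infsumI)
  qed
  have "((\<lambda>F. sqrt (infsum ?f UNIV - sum ?f F)) \<longlongrightarrow> sqrt (infsum ?f UNIV - infsum ?f UNIV))
      (finite_subsets_at_top UNIV)"
    by (intro tendsto_intros infsum_tendsto s)
  then have lim: "((\<lambda>F. sqrt (infsum ?f UNIV - sum ?f F)) \<longlongrightarrow> 0) (finite_subsets_at_top UNIV)"
    by simp
  show ?thesis
    by (rule tendsto_cong[THEN iffD1, OF _ lim])
      (auto intro!: eventually_finite_subsets_at_top_weakI simp: l2_norm_def eq)
qed

definition mat_op :: "(int \<Rightarrow> int \<Rightarrow> complex) \<Rightarrow> (int \<Rightarrow> complex) \<Rightarrow> int \<Rightarrow> complex" where
  "mat_op a \<xi> p = (\<Sum>\<^sub>\<infinity>q\<in>UNIV. a p q * \<xi> q)"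

text \<open>Convergence of every row sum belongs to the notion: \<open>infsum\<close> is 0 on a
  divergent family, so a norm estimate alone could hold for the wrong reason.\<close>

definition mat_bound :: "(int \<Rightarrow> int \<Rightarrow> complex) \<Rightarrow> real \<Rightarrow> bool" where
  "mat_bound a C \<longleftrightarrow> C \<ge> 0 \<and> (\<forall>\<xi>\<in>l2. (\<forall>p. (\<lambda>q. a p q * \<xi> q) summable_on UNIV) \<and>
     mat_op a \<xi> \<in> l2 \<and> l2_norm (mat_op a \<xi>) \<le> C * l2_norm \<xi>)"

lemma mat_boundD:
  assumes "mat_bound a C"
  shows "C \<ge> 0"
    and "\<xi> \<in> l2 \<Longrightarrow> (\<lambda>q. a p q * \<xi> q) summable_on UNIV"
    and "\<xi> \<in> l2 \<Longrightarrow> mat_op a \<xi> \<in> l2"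
    and "\<xi> \<in> l2 \<Longrightarrow> l2_norm (mat_op a \<xi>) \<le> C * l2_norm \<xi>"
  using assms by (auto simp: mat_bound_def)

lemma mat_op_restr:
  assumes "finite F"
  shows "mat_op a (restr F \<xi>) p = (\<Sum>q\<in>F. a p q * \<xi> q)"
  unfolding mat_op_def using assms
  by (intro infsumI has_sum_finite_neutralI[where B = F]) (auto simp: restr_def intro!: sum.cong)

lemma mat_op_diff:
  assumes "mat_bound a C" "\<xi> \<in> l2" "\<eta> \<in> l2"
  shows "mat_op a (\<lambda>p. \<xi> p - \<eta> p) p = mat_op a \<xi> p - mat_op a \<eta> p"
  unfolding mat_op_def
  by (intro infsumI) (auto simp: right_diff_distrib intro!: has_sum_diff has_sum_infsum mat_boundD[OF assms(1)] assms)

text \<open>Both sides reduce to the same finite combination of row sums of \<open>a\<close>; on the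
  right, hermiticity turns the conjugated columns of \<open>a\<close> that occur into rows.\<close>

lemma l2_inner_mat_op_restr:
  assumes "mat_bound a C" and herm: "\<And>p q. a p q = cnj (a q p)"
    and "finite F" "\<xi> \<in> l2" "\<eta> \<in> l2"
  shows "l2_inner (restr F \<xi>) (mat_op a \<eta>) = l2_inner (mat_op a (restr F \<xi>)) \<eta>"
proof -
  have "l2_inner (restr F \<xi>) (mat_op a \<eta>) = (\<Sum>p\<in>F. cnj (\<xi> p) * mat_op a \<eta> p)"
    unfolding l2_inner_def using \<open>finite F\<close>
    by (intro infsumI has_sum_finite_neutralI[where B = F]) (auto simp: restr_def intro!: sum.cong)
  moreover have "l2_inner (mat_op a (restr F \<xi>)) \<eta> = (\<Sum>p\<in>F. cnj (\<xi> p) * mat_op a \<eta> p)"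
    unfolding l2_inner_def
  proof (rule infsumI)
    have "((\<lambda>q. \<Sum>p\<in>F. cnj (\<xi> p) * (a p q * \<eta> q)) has_sum (\<Sum>p\<in>F. cnj (\<xi> p) * mat_op a \<eta> p)) UNIV"
      unfolding mat_op_def
      by (intro has_sum_sum has_sum_cmult_right has_sum_infsum mat_boundD(2)[OF assms(1)] assms)
    moreover have "(\<Sum>p\<in>F. cnj (\<xi> p) * (a p q * \<eta> q)) = cnj (mat_op a (restr F \<xi>) q) * \<eta> q" for q
      unfolding mat_op_restr[OF \<open>finite F\<close>] cnj_sum sum_distrib_right
      by (rule sum.cong) (auto simp: herm[of _ q])
    ultimately show "((\<lambda>q. cnj (mat_op a (restr F \<xi>) q) * \<eta> q) has_sum
        (\<Sum>p\<in>F. cnj (\<xi> p) * mat_op a \<eta> p)) UNIV"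
      by simp
  qed
  ultimately show ?thesis by simp
qed

lemma l2_inner_diff_left:
  assumes "\<xi> \<in> l2" "\<xi>' \<in> l2" "\<eta> \<in> l2"
  shows "l2_inner (\<lambda>p. \<xi> p - \<xi>' p) \<eta> = l2_inner \<xi> \<eta> - l2_inner \<xi>' \<eta>"
  unfolding l2_inner_def
  by (intro infsumI)
    (auto simp: left_diff_distrib intro!: has_sum_diff has_sum_infsum l2_inner_summable assms)

lemma l2_inner_diff_right:
  assumes "\<xi> \<in> l2" "\<xi>' \<in> l2" "\<eta> \<in> l2"
  shows "l2_inner \<eta> (\<lambda>p. \<xi> p - \<xi>' p) = l2_inner \<eta> \<xi> - l2_inner \<eta> \<xi>'"
  unfolding l2_inner_def
  by (intro infsumI)
    (auto simp: right_diff_distrib intro!: has_sum_diff has_sum_infsum l2_inner_summable assms)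

text \<open>
  The double sum need not converge absolutely, so the sums are exchanged for finitely
  supported \<open>\<xi>\<close> only, and boundedness gives the general case.
\<close>

lemma l2_inner_mat_op:
  assumes bd: "mat_bound a C" and herm: "\<And>p q. a p q = cnj (a q p)"
    and "\<xi> \<in> l2" "\<eta> \<in> l2"
  shows "l2_inner \<xi> (mat_op a \<eta>) = l2_inner (mat_op a \<xi>) \<eta>"
proof -
  note mb = mat_boundD[OF bd]
  have lim0: "((\<lambda>F. K * l2_norm (\<lambda>p. \<xi> p - restr F \<xi> p)) \<longlongrightarrow> 0) (finite_subsets_at_top UNIV)" for K
    using tendsto_mult_right_zero[OF tendsto_l2_norm_restr[OF assms(3)]] .
  have 1: "((\<lambda>F. l2_inner \<xi> (mat_op a \<eta>) - l2_inner (restr F \<xi>) (mat_op a \<eta>)) \<longlongrightarrow> 0)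
      (finite_subsets_at_top UNIV)"
  proof (rule Lim_null_comparison[OF _ lim0[of "l2_norm (mat_op a \<eta>)"]], rule always_eventually, rule allI)
    fix F
    show "cmod (l2_inner \<xi> (mat_op a \<eta>) - l2_inner (restr F \<xi>) (mat_op a \<eta>))
        \<le> l2_norm (mat_op a \<eta>) * l2_norm (\<lambda>p. \<xi> p - restr F \<xi> p)"
      using cmod_l2_inner_le[of "\<lambda>p. \<xi> p - restr F \<xi> p" "mat_op a \<eta>"]
      by (simp add: l2_inner_diff_left l2_diff restr_l2 mb assms mult.commute)
  qed
  have 2: "((\<lambda>F. l2_inner (mat_op a \<xi>) \<eta> - l2_inner (mat_op a (restr F \<xi>)) \<eta>) \<longlongrightarrow> 0)
      (finite_subsets_at_top UNIV)"
  proof (rule Lim_null_comparison[OF _ lim0[of "C * l2_norm \<eta>"]], rule always_eventually, rule allI)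
    fix F
    let ?d = "\<lambda>p. \<xi> p - restr F \<xi> p"
    have d: "?d \<in> l2" by (intro l2_diff restr_l2 assms)
    have "mat_op a ?d = (\<lambda>p. mat_op a \<xi> p - mat_op a (restr F \<xi>) p)"
      by (intro ext mat_op_diff[OF bd] assms restr_l2)
    then have "l2_inner (mat_op a \<xi>) \<eta> - l2_inner (mat_op a (restr F \<xi>)) \<eta> = l2_inner (mat_op a ?d) \<eta>"
      by (simp add: l2_inner_diff_left mb assms restr_l2)
    also have "cmod \<dots> \<le> l2_norm (mat_op a ?d) * l2_norm \<eta>"
      by (intro cmod_l2_inner_le mb d assms)
    also have "\<dots> \<le> (C * l2_norm ?d) * l2_norm \<eta>"
      by (intro mult_right_mono mb d l2_norm_nonneg)
    finally show "cmod (l2_inner (mat_op a \<xi>) \<eta> - l2_inner (mat_op a (restr F \<xi>)) \<eta>)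
        \<le> C * l2_norm \<eta> * l2_norm ?d"
      by (simp add: mult_ac)
  qed
  \<comment> \<open>For finite \<open>F\<close> the truncated terms cancel, so the difference of the
    two null limits is the constant difference of the two sides, which must therefore
    vanish.\<close>
  have "((\<lambda>F :: int set. l2_inner \<xi> (mat_op a \<eta>) - l2_inner (mat_op a \<xi>) \<eta>) \<longlongrightarrow> 0 - 0)
      (finite_subsets_at_top UNIV)"
  proof (rule Lim_transform_eventually[OF tendsto_diff[OF 1 2]], rule eventually_finite_subsets_at_top_weakI)
    fix F :: "int set"
    assume "finite F"
    then show "l2_inner \<xi> (mat_op a \<eta>) - l2_inner (restr F \<xi>) (mat_op a \<eta>)
        - (l2_inner (mat_op a \<xi>) \<eta> - l2_inner (mat_op a (restr F \<xi>)) \<eta>)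
      = l2_inner \<xi> (mat_op a \<eta>) - l2_inner (mat_op a \<xi>) \<eta>"
      by (simp add: l2_inner_mat_op_restr[OF bd herm _ assms(3,4)])
  qed
  then show ?thesis
    by (auto simp: tendsto_const_iff)
qed

lemma mat_op_unit_vector: "mat_op a (\<lambda>r. if r = q then 1 else 0) = (\<lambda>p. a p q)"
proof
  fix p
  show "mat_op a (\<lambda>r. if r = q then 1 else 0) p = a p q"
    unfolding mat_op_def
    by (intro infsumI has_sum_finite_neutralI[where B = "{q}"]) auto
qed

lemma unit_vector_l2: "(\<lambda>r. if r = q then 1 else 0) \<in> l2"
  and l2_norm_unit_vector: "l2_norm (\<lambda>r. if r = q then 1 else 0) = 1"
proof -
  have h: "((\<lambda>p. (cmod (if p = q then 1 else 0))\<^sup>2) has_sum 1) (UNIV :: int set)"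
    by (intro has_sum_finite_neutralI[where B = "{q}"]) auto
  from h show "(\<lambda>r. if r = q then 1 else 0) \<in> l2"
    by (auto simp: l2_def summable_on_def)
  from h show "l2_norm (\<lambda>r. if r = q then 1 else 0) = 1"
    by (simp add: l2_norm_def infsumI)
qed

text \<open>A column is the image of a unit vector, which has norm 1.\<close>

lemma mat_column_l2:
  assumes "mat_bound a C"
  shows "(\<lambda>p. a p q) \<in> l2" and "l2_norm (\<lambda>p. a p q) \<le> C"
  using mat_boundD(3,4)[OF assms unit_vector_l2[of q]] by (auto simp: mat_op_unit_vector l2_norm_unit_vector)

text \<open>The hypothesis \<open>idem\<close> concerns entries, and associativity of infinite
  matrix products is not automatic. By hermiticity the value at \<open>p\<close> is an inner product
  with column \<open>p\<close>; moving one factor across the inner product makes \<open>a\<close>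
  act on that column, where \<open>idem\<close> applies.\<close>

lemma mat_op_idem:
  assumes bd: "mat_bound a C" and herm: "\<And>p q. a p q = cnj (a q p)"
    and idem: "\<And>p q. mat_op a (\<lambda>r. a r q) p = a p q" and "\<eta> \<in> l2"
  shows "mat_op a (mat_op a \<eta>) = mat_op a \<eta>"
proof
  fix p
  have row: "l2_inner (\<lambda>r. a r p) \<zeta> = mat_op a \<zeta> p" for \<zeta>
    unfolding l2_inner_def mat_op_def by (simp flip: herm)
  have col: "mat_op a (\<lambda>r. a r p) = (\<lambda>r. a r p)"
    by (rule ext) (rule idem)
  have "mat_op a (mat_op a \<eta>) p = l2_inner (\<lambda>r. a r p) (mat_op a \<eta>)"
    by (simp add: row)
  also have "\<dots> = l2_inner (mat_op a (\<lambda>r. a r p)) \<eta>"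
    by (rule l2_inner_mat_op[OF bd herm mat_column_l2(1)[OF bd] \<open>\<eta> \<in> l2\<close>])
  also have "\<dots> = mat_op a \<eta> p"
    by (simp only: row col)
  finally show "mat_op a (mat_op a \<eta>) p = mat_op a \<eta> p" .
qed

text \<open>For a self-adjoint idempotent the squared norm of the image equals the inner product of
  the image with \<open>\<eta>\<close>; Cauchy-Schwarz and cancelling one factor replace the bound
  \<open>C\<close> by 1.\<close>

lemma l2_norm_projection_le:
  assumes bd: "mat_bound a C" and herm: "\<And>p q. a p q = cnj (a q p)"
    and idem: "\<And>p q. mat_op a (\<lambda>r. a r q) p = a p q" and "\<eta> \<in> l2"
  shows "l2_norm (mat_op a \<eta>) \<le> l2_norm \<eta>"
proof -
  let ?T = "mat_op a \<eta>"
  have T: "?T \<in> l2" by (rule mat_boundD(3)[OF bd \<open>\<eta> \<in> l2\<close>])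
  have "of_real ((l2_norm ?T)\<^sup>2) = l2_inner ?T ?T"
    by (simp add: l2_inner_self T)
  also have "\<dots> = l2_inner (mat_op a ?T) \<eta>"
    by (rule l2_inner_mat_op[OF bd herm T \<open>\<eta> \<in> l2\<close>])
  also have "\<dots> = l2_inner ?T \<eta>"
    by (simp add: mat_op_idem[OF bd herm idem \<open>\<eta> \<in> l2\<close>])
  finally have "cmod (of_real ((l2_norm ?T)\<^sup>2)) = cmod (l2_inner ?T \<eta>)" by simp
  then have "l2_norm ?T * l2_norm ?T \<le> l2_norm ?T * l2_norm \<eta>"
    using cmod_l2_inner_le[OF T \<open>\<eta> \<in> l2\<close>] by (simp add: power2_eq_square norm_mult)
  then show ?thesis
    using l2_norm_nonneg[of ?T] l2_norm_nonneg[of \<eta>] mult_le_cancel_left_pos[of "l2_norm ?T"]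
    by (cases "l2_norm ?T = 0") auto
qed

section \<open>The regular representation\<close>

text \<open>The matrix of \<open>reg_rep\<close> over \<open>(x, y)\<close>, read off after
  substituting \<open>p - q\<close> for the summation index.\<close>

definition reg_mat :: "real \<Rightarrow> real \<Rightarrow> cfun \<Rightarrow> real \<Rightarrow> real \<Rightarrow> int \<Rightarrow> int \<Rightarrow> complex" where
  "reg_mat \<mu> \<nu> \<Phi> x y p q = \<Phi> (x + 2 * of_int p * \<mu>) (y + 2 * of_int p * \<nu>) (p - q)"

text \<open>Column 0 of \<open>reg_mat\<close>. Its squared norm is coefficient 0 at
  \<open>(x, y)\<close> of the product of the adjoint of \<open>\<Phi>\<close> with
  \<open>\<Phi>\<close>, which is all that the trace sees.\<close>

definition reg_col :: "real \<Rightarrow> real \<Rightarrow> cfun \<Rightarrow> real \<Rightarrow> real \<Rightarrow> int \<Rightarrow> complex" where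
  "reg_col \<mu> \<nu> \<Phi> x y p = \<Phi> (x + 2 * of_int p * \<mu>) (y + 2 * of_int p * \<nu>) p"

lemma reg_col_eq: "reg_col \<mu> \<nu> \<Phi> x y = (\<lambda>p. reg_mat \<mu> \<nu> \<Phi> x y p 0)"
  by (simp add: reg_col_def reg_mat_def fun_eq_iff)

lemma bij_int_diff: "bij (\<lambda>q. p - q :: int)"
  by (rule o_bij[of "\<lambda>q. p - q"]) auto

lemma reg_rep_eq_mat_op: "reg_rep \<mu> \<nu> \<Phi> x y \<xi> = mat_op (reg_mat \<mu> \<nu> \<Phi> x y) \<xi>"
proof
  fix p
  show "reg_rep \<mu> \<nu> \<Phi> x y \<xi> p = mat_op (reg_mat \<mu> \<nu> \<Phi> x y) \<xi> p"
    using infsum_reindex_bij_betw[OF bij_int_diff[of p],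
      of "\<lambda>q. \<Phi> (x + 2 * of_int p * \<mu>) (y + 2 * of_int p * \<nu>) q * \<xi> (p - q)"]
    by (simp add: reg_rep_def mat_op_def reg_mat_def)
qed

lemma reg_bound_iff_mat_bound:
  "reg_bound \<mu> \<nu> \<Phi> C \<longleftrightarrow> (\<forall>x y. mat_bound (reg_mat \<mu> \<nu> \<Phi> x y) C)"
proof -
  have "(\<lambda>q. \<Phi> (x + 2 * of_int p * \<mu>) (y + 2 * of_int p * \<nu>) q * \<xi> (p - q)) summable_on UNIV
      \<longleftrightarrow> (\<lambda>q. reg_mat \<mu> \<nu> \<Phi> x y p q * \<xi> q) summable_on UNIV" for p x y \<xi>
    using summable_on_reindex_bij_betw[OF bij_int_diff[of p],
      of "\<lambda>q. \<Phi> (x + 2 * of_int p * \<mu>) (y + 2 * of_int p * \<nu>) q * \<xi> (p - q)"]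
    by (simp add: reg_mat_def)
  then show ?thesis
    by (auto simp: reg_bound_def mat_bound_def reg_rep_eq_mat_op)
qed

lemma reg_boundedE:
  assumes "\<Phi> \<in> reg_bounded \<mu> \<nu>"
  obtains C where "C \<ge> 0" "\<And>x y. mat_bound (reg_mat \<mu> \<nu> \<Phi> x y) C"
  using assms mat_boundD(1) unfolding reg_bounded_def reg_bound_iff_mat_bound by blast

lemma reg_col_l2:
  assumes "mat_bound (reg_mat \<mu> \<nu> \<Phi> x y) C"
  shows "reg_col \<mu> \<nu> \<Phi> x y \<in> l2" and "l2_norm (reg_col \<mu> \<nu> \<Phi> x y) \<le> C"
  unfolding reg_col_eq by (fact mat_column_l2[OF assms])+

lemma reg_col_in_l2: "\<Phi> \<in> reg_bounded \<mu> \<nu> \<Longrightarrow> reg_col \<mu> \<nu> \<Phi> x y \<in> l2"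
  by (meson reg_boundedE reg_col_l2(1))

text \<open>Every coefficient is an entry of column 0 over a translated point, so the bound on
  columns covers it. Norm convergence thereby controls coefficients.\<close>

lemma reg_bound_coeff_le:
  assumes "reg_bound \<mu> \<nu> \<Phi> C"
  shows "cmod (\<Phi> x y p) \<le> C"
proof -
  have mb: "mat_bound (reg_mat \<mu> \<nu> \<Phi> (x - 2 * of_int p * \<mu>) (y - 2 * of_int p * \<nu>)) C"
    using assms by (simp add: reg_bound_iff_mat_bound)
  have "cmod (reg_col \<mu> \<nu> \<Phi> (x - 2 * of_int p * \<mu>) (y - 2 * of_int p * \<nu>) p) \<le> C"
    using cmod_le_l2_norm[OF reg_col_l2(1)[OF mb], of p] reg_col_l2(2)[OF mb] by linarith
  then show ?thesis by (simp add: reg_col_def)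
qed

text \<open>As \<open>cp_norm\<close> has a meaning on \<open>reg_bounded\<close> only, difference
  quotients must be known to stay in this set before their norms can be exploited.\<close>

lemma reg_bounded_diff:
  assumes "\<Phi> \<in> reg_bounded \<mu> \<nu>" "\<Psi> \<in> reg_bounded \<mu> \<nu>"
  shows "\<Phi> - \<Psi> \<in> reg_bounded \<mu> \<nu>"
proof -
  obtain C where C: "C \<ge> 0" "\<And>x y. mat_bound (reg_mat \<mu> \<nu> \<Phi> x y) C"
    using reg_boundedE[OF assms(1)] by blast
  obtain D where D: "D \<ge> 0" "\<And>x y. mat_bound (reg_mat \<mu> \<nu> \<Psi> x y) D"
    using reg_boundedE[OF assms(2)] by blast
  \<comment> \<open>The constant is the one that \<open>l2_norm_diff_le\<close> yields; membership
    asks for any finite one.\<close>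
  have "mat_bound (reg_mat \<mu> \<nu> (\<Phi> - \<Psi>) x y) (sqrt (2 * C\<^sup>2 + 2 * D\<^sup>2))" for x y
    unfolding mat_bound_def
  proof (intro conjI ballI allI)
    fix \<xi> :: "int \<Rightarrow> complex"
    assume \<xi>: "\<xi> \<in> l2"
    let ?a = "reg_mat \<mu> \<nu> \<Phi> x y" and ?b = "reg_mat \<mu> \<nu> \<Psi> x y" and ?d = "reg_mat \<mu> \<nu> (\<Phi> - \<Psi>) x y"
    have d: "?d p q * \<xi> q = ?a p q * \<xi> q - ?b p q * \<xi> q" for p q
      by (simp add: reg_mat_def left_diff_distrib)
    have s: "((\<lambda>q. ?d p q * \<xi> q) has_sum (mat_op ?a \<xi> p - mat_op ?b \<xi> p)) UNIV" for p
      unfolding d mat_op_def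
      by (intro has_sum_diff has_sum_infsum mat_boundD(2)[OF C(2)] mat_boundD(2)[OF D(2)] \<xi>)
    show "(\<lambda>q. ?d p q * \<xi> q) summable_on UNIV" for p
      using s summable_on_def by blast
    have op: "mat_op ?d \<xi> = (\<lambda>p. mat_op ?a \<xi> p - mat_op ?b \<xi> p)"
      by (rule ext) (use s in \<open>simp add: mat_op_def[of ?d] infsumI\<close>)
    note l = mat_boundD(3)[OF C(2) \<xi>] mat_boundD(3)[OF D(2) \<xi>]
    show "mat_op ?d \<xi> \<in> l2"
      unfolding op by (intro l2_diff l)
    have "(l2_norm (mat_op ?d \<xi>))\<^sup>2 \<le> 2 * (l2_norm (mat_op ?a \<xi>))\<^sup>2 + 2 * (l2_norm (mat_op ?b \<xi>))\<^sup>2"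
      unfolding op by (intro l2_norm_diff_le l)
    also have "\<dots> \<le> 2 * (C * l2_norm \<xi>)\<^sup>2 + 2 * (D * l2_norm \<xi>)\<^sup>2"
      by (intro add_mono mult_left_mono power_mono mat_boundD(4)[OF C(2) \<xi>] mat_boundD(4)[OF D(2) \<xi>])
        (auto simp: l2_norm_nonneg)
    also have "\<dots> = (sqrt (2 * C\<^sup>2 + 2 * D\<^sup>2) * l2_norm \<xi>)\<^sup>2"
      by (simp add: power_mult_distrib algebra_simps)
    finally show "l2_norm (mat_op ?d \<xi>) \<le> sqrt (2 * C\<^sup>2 + 2 * D\<^sup>2) * l2_norm \<xi>"
      by (rule power2_le_imp_le) (simp add: l2_norm_nonneg)
  qed simp
  then show ?thesis
    unfolding reg_bounded_def reg_bound_iff_mat_bound by blast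
qed

lemma reg_bounded_cscale:
  assumes "\<Phi> \<in> reg_bounded \<mu> \<nu>"
  shows "cscale a \<Phi> \<in> reg_bounded \<mu> \<nu>"
proof -
  obtain C where C: "C \<ge> 0" "\<And>x y. mat_bound (reg_mat \<mu> \<nu> \<Phi> x y) C"
    using reg_boundedE[OF assms(1)] by blast
  have "mat_bound (reg_mat \<mu> \<nu> (cscale a \<Phi>) x y) (cmod a * C)" for x y
    unfolding mat_bound_def
  proof (intro conjI ballI allI)
    fix \<xi> :: "int \<Rightarrow> complex"
    assume \<xi>: "\<xi> \<in> l2"
    let ?a = "reg_mat \<mu> \<nu> \<Phi> x y" and ?d = "reg_mat \<mu> \<nu> (cscale a \<Phi>) x y"
    have d: "?d p q * \<xi> q = a * (?a p q * \<xi> q)" for p q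
      by (simp add: reg_mat_def cscale_def)
    show "(\<lambda>q. ?d p q * \<xi> q) summable_on UNIV" for p
      unfolding d by (intro summable_on_cmult_right mat_boundD(2)[OF C(2)] \<xi>)
    have op: "mat_op ?d \<xi> = (\<lambda>p. a * mat_op ?a \<xi> p)"
      by (rule ext) (simp add: mat_op_def d infsum_cmult_right')
    show "mat_op ?d \<xi> \<in> l2"
      unfolding op by (intro l2_cmult mat_boundD(3)[OF C(2)] \<xi>)
    show "l2_norm (mat_op ?d \<xi>) \<le> cmod a * C * l2_norm \<xi>"
      unfolding op l2_norm_cmult mult.assoc by (intro mult_left_mono mat_boundD(4)[OF C(2)] \<xi>) simp
  qed (simp add: C)
  then show ?thesis
    unfolding reg_bounded_def reg_bound_iff_mat_bound by blast
qed

text \<open>The regular representation is multiplicative. Entrywise this is a reindexing of one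
  \<open>infsum\<close> along a bijection, hence free of convergence conditions.\<close>

lemma reg_mat_cp_prod:
  "mat_op (reg_mat \<mu> \<nu> \<Phi> x y) (\<lambda>r. reg_mat \<mu> \<nu> \<Psi> x y r q) p = reg_mat \<mu> \<nu> (cp_prod \<mu> \<nu> \<Phi> \<Psi>) x y p q"
proof -
  have "mat_op (reg_mat \<mu> \<nu> \<Phi> x y) (\<lambda>r. reg_mat \<mu> \<nu> \<Psi> x y r q) p
      = (\<Sum>\<^sub>\<infinity>s\<in>UNIV. reg_mat \<mu> \<nu> \<Phi> x y p (p - s) * reg_mat \<mu> \<nu> \<Psi> x y (p - s) q)"
    unfolding mat_op_def by (rule infsum_reindex_bij_betw[OF bij_int_diff, symmetric])
  also have "\<dots> = reg_mat \<mu> \<nu> (cp_prod \<mu> \<nu> \<Phi> \<Psi>) x y p q"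
    by (simp add: reg_mat_def cp_prod_def algebra_simps)
  finally show ?thesis .
qed

lemma reg_col_cp_prod:
  "reg_col \<mu> \<nu> (cp_prod \<mu> \<nu> \<Phi> \<Psi>) x y = mat_op (reg_mat \<mu> \<nu> \<Phi> x y) (reg_col \<mu> \<nu> \<Psi> x y)"
  by (rule ext) (simp add: reg_col_eq reg_mat_cp_prod)

lemma cp_star_fixed:
  assumes "cp_star \<mu> \<nu> \<Phi> = \<Phi>"
  shows "cnj (\<Phi> (x - 2 * of_int p * \<mu>) (y - 2 * of_int p * \<nu>) (- p)) = \<Phi> x y p"
proof -
  have "cp_star \<mu> \<nu> \<Phi> x y p = \<Phi> x y p" using assms by simp
  then show ?thesis by (simp add: cp_star_def)
qed

lemma reg_mat_hermitian:
  assumes "cp_star \<mu> \<nu> \<Phi> = \<Phi>"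
  shows "reg_mat \<mu> \<nu> \<Phi> x y p q = cnj (reg_mat \<mu> \<nu> \<Phi> x y q p)"
  using cp_star_fixed[OF assms, of "x + 2 * of_int p * \<mu>" "p - q" "y + 2 * of_int p * \<nu>"]
  by (simp add: reg_mat_def algebra_simps)

text \<open>Coefficient 0 is the \<open>(0, 0)\<close> entry of the matrix product, row 0 of
  \<open>\<Phi>\<close> against column 0 of \<open>\<Psi>\<close>; self-adjointness makes that row
  the conjugate of column 0.\<close>

lemma cp_prod_at_0:
  assumes "cp_star \<mu> \<nu> \<Phi> = \<Phi>"
  shows "cp_prod \<mu> \<nu> \<Phi> \<Psi> x y 0 = l2_inner (reg_col \<mu> \<nu> \<Phi> x y) (reg_col \<mu> \<nu> \<Psi> x y)"
proof -
  have "cp_prod \<mu> \<nu> \<Phi> \<Psi> x y 0 = mat_op (reg_mat \<mu> \<nu> \<Phi> x y) (reg_col \<mu> \<nu> \<Psi> x y) 0"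
    unfolding reg_col_cp_prod[symmetric] by (simp add: reg_col_def)
  then show ?thesis
    by (simp add: mat_op_def l2_inner_def reg_col_eq reg_mat_hermitian[OF assms, of x y 0])
qed

text \<open>Column 0 of \<open>AB\<close> is \<open>A\<close> applied to column 0 of
  \<open>B\<close>, and the self-adjoint outer factor moves across the inner product to
  \<open>P\<close>. This is the fibrewise identity; the trace property does not enter yet.\<close>

lemma cp_prod_commutator_at_0:
  assumes P: "cp_star \<mu> \<nu> P = P" "P \<in> reg_bounded \<mu> \<nu>"
    and A: "cp_star \<mu> \<nu> A = A" "A \<in> reg_bounded \<mu> \<nu>"
    and B: "cp_star \<mu> \<nu> B = B" "B \<in> reg_bounded \<mu> \<nu>"
  shows "cp_prod \<mu> \<nu> P (cp_prod \<mu> \<nu> A B - cp_prod \<mu> \<nu> B A) x y 0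
    = l2_inner (reg_col \<mu> \<nu> (cp_prod \<mu> \<nu> A P) x y) (reg_col \<mu> \<nu> B x y)
    - l2_inner (reg_col \<mu> \<nu> (cp_prod \<mu> \<nu> B P) x y) (reg_col \<mu> \<nu> A x y)"
proof -
  obtain C where "C \<ge> 0" and C: "\<And>x y. mat_bound (reg_mat \<mu> \<nu> A x y) C"
    using reg_boundedE[OF A(2)] by blast
  obtain D where "D \<ge> 0" and D: "\<And>x y. mat_bound (reg_mat \<mu> \<nu> B x y) D"
    using reg_boundedE[OF B(2)] by blast
  note l = reg_col_in_l2[OF P(2)] reg_col_in_l2[OF A(2)] reg_col_in_l2[OF B(2)]
  have "reg_col \<mu> \<nu> (cp_prod \<mu> \<nu> A B - cp_prod \<mu> \<nu> B A) x y
      = (\<lambda>p. reg_col \<mu> \<nu> (cp_prod \<mu> \<nu> A B) x y p - reg_col \<mu> \<nu> (cp_prod \<mu> \<nu> B A) x y p)"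
    by (rule ext) (simp add: reg_col_def)
  then have "cp_prod \<mu> \<nu> P (cp_prod \<mu> \<nu> A B - cp_prod \<mu> \<nu> B A) x y 0
    = l2_inner (reg_col \<mu> \<nu> P x y) (mat_op (reg_mat \<mu> \<nu> A x y) (reg_col \<mu> \<nu> B x y))
    - l2_inner (reg_col \<mu> \<nu> P x y) (mat_op (reg_mat \<mu> \<nu> B x y) (reg_col \<mu> \<nu> A x y))"
    by (simp add: cp_prod_at_0[OF P(1)] reg_col_cp_prod l2_inner_diff_right l
        mat_boundD(3)[OF C] mat_boundD(3)[OF D])
  then show ?thesis
    by (simp add: reg_col_cp_prod l2_inner_mat_op[OF C reg_mat_hermitian[OF A(1)]]
        l2_inner_mat_op[OF D reg_mat_hermitian[OF B(1)]] l)
qed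

text \<open>This expresses that \<open>AB\<close> is the adjoint of \<open>BA\<close>. Over the
  translated point the coefficient is the entry \<open>(p, 0)\<close>, and hermiticity of both
  factors transposes the matrix product term by term.\<close>

lemma cp_prod_flip:
  assumes A: "cp_star \<mu> \<nu> A = A" and B: "cp_star \<mu> \<nu> B = B"
  shows "cp_prod \<mu> \<nu> A B x y p
    = cnj (cp_prod \<mu> \<nu> B A (x - 2 * of_int p * \<mu>) (y - 2 * of_int p * \<nu>) (- p))"
proof -
  have "cp_prod \<mu> \<nu> A B x y p
      = reg_mat \<mu> \<nu> (cp_prod \<mu> \<nu> A B) (x - 2 * of_int p * \<mu>) (y - 2 * of_int p * \<nu>) p 0"
    by (simp add: reg_mat_def)
  also have "\<dots> = cnj (reg_mat \<mu> \<nu> (cp_prod \<mu> \<nu> B A) (x - 2 * of_int p * \<mu>) (y - 2 * of_int p * \<nu>) 0 p)"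
    unfolding reg_mat_cp_prod[symmetric] mat_op_def infsum_cnj[symmetric] complex_cnj_mult
  proof (rule infsum_cong)
    fix r
    let ?x = "x - 2 * of_int p * \<mu>" and ?y = "y - 2 * of_int p * \<nu>"
    show "reg_mat \<mu> \<nu> A ?x ?y p r * reg_mat \<mu> \<nu> B ?x ?y r 0
        = cnj (reg_mat \<mu> \<nu> B ?x ?y 0 r) * cnj (reg_mat \<mu> \<nu> A ?x ?y r p)"
      unfolding reg_mat_hermitian[OF A, of ?x ?y p r] reg_mat_hermitian[OF B, of ?x ?y r 0]
      by (rule mult.commute)
  qed
  finally show ?thesis by (simp add: reg_mat_def)
qed

text \<open>Left multiplication by \<open>P\<close> acts on column 0 as a projection in each fibre.
  Right multiplication does not act on columns, so \<open>AP\<close> is estimated only after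
  integration.\<close>

lemma l2_norm_reg_col_projection_le:
  assumes P: "QHM_projection \<mu> \<nu> P" "P \<in> reg_bounded \<mu> \<nu>" and A: "A \<in> reg_bounded \<mu> \<nu>"
  shows "l2_norm (reg_col \<mu> \<nu> (cp_prod \<mu> \<nu> P A) x y) \<le> l2_norm (reg_col \<mu> \<nu> A x y)"
proof -
  obtain C where "C \<ge> 0" and C: "\<And>x y. mat_bound (reg_mat \<mu> \<nu> P x y) C"
    using reg_boundedE[OF P(2)] by blast
  have s: "cp_star \<mu> \<nu> P = P" "cp_prod \<mu> \<nu> P P = P"
    using P(1) by (auto simp: QHM_projection_def)
  show ?thesis
    unfolding reg_col_cp_prod
    by (rule l2_norm_projection_le[OF C reg_mat_hermitian[OF s(1)] _ reg_col_in_l2[OF A]])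
      (simp add: reg_mat_cp_prod s)
qed

section \<open>Smooth elements and the infinitesimal action\<close>

lemma cp_norm_less_imp_coeff_less:
  assumes "\<Phi> \<in> reg_bounded \<mu> \<nu>" "cp_norm \<mu> \<nu> \<Phi> < \<epsilon>"
  shows "cmod (\<Phi> x y p) < \<epsilon>"
proof -
  \<comment> \<open>An infimum below \<open>\<epsilon>\<close> yields an actual bound below
    \<open>\<epsilon>\<close> only when the set of bounds is nonempty.\<close>
  have "{C. reg_bound \<mu> \<nu> \<Phi> C} \<noteq> {}"
    using assms(1) by (auto simp: reg_bounded_def)
  from cInf_lessD[OF this assms(2)[unfolded cp_norm_def]]
  obtain C where "reg_bound \<mu> \<nu> \<Phi> C" "C < \<epsilon>" by auto
  then show ?thesis
    using reg_bound_coeff_le[of \<mu> \<nu> \<Phi> C x y p] by linarith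
qed

lemma cp_norm_tendsto_imp_coeff_tendsto:
  assumes "\<And>u. \<Psi> u - \<Phi> \<in> reg_bounded \<mu> \<nu>" "((\<lambda>u. cp_norm \<mu> \<nu> (\<Psi> u - \<Phi>)) \<longlongrightarrow> 0) F"
  shows "((\<lambda>u. \<Psi> u x y p) \<longlongrightarrow> \<Phi> x y p) F"
proof (rule tendstoI)
  fix \<epsilon> :: real
  assume "\<epsilon> > 0"
  with assms(2) have "\<forall>\<^sub>F u in F. cp_norm \<mu> \<nu> (\<Psi> u - \<Phi>) < \<epsilon>"
    by (rule order_tendstoD)
  then show "\<forall>\<^sub>F u in F. dist (\<Psi> u x y p) (\<Phi> x y p) < \<epsilon>"
  proof eventually_elim
    case (elim u)
    show ?case
      using cp_norm_less_imp_coeff_less[OF assms(1) elim, of x y p] by (simp add: dist_norm)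
  qed
qed

text \<open>The equivariance of \<open>D0\<close> for \<open>k = 1\<close>, solved for the
  translated value, together with periodicity in \<open>y\<close>. The factor has modulus 1, so
  moduli of coefficients are functions on the torus.\<close>

definition quasi_periodic :: "nat \<Rightarrow> real \<Rightarrow> cfun \<Rightarrow> bool" where
  "quasi_periodic c \<nu> \<Phi> \<longleftrightarrow> (\<forall>x y p. \<Phi> x (y + 1) p = \<Phi> x y p \<and>
     \<Phi> (x + 1) y p = ex (of_nat c * of_int p * (y - of_int p * \<nu>)) * \<Phi> x y p)"

lemma ex_add: "ex (s + t) = ex s * ex t"
  by (simp add: ex_def exp_add ring_distribs)

lemma ex_0 [simp]: "ex 0 = 1"
  by (simp add: ex_def)

lemma norm_ex [simp]: "cmod (ex t) = 1"
  by (simp add: ex_def norm_exp_eq_Re)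

lemma cnj_ex: "cnj (ex t) = ex (- t)"
  by (simp add: ex_def exp_cnj)

lemma quasi_periodicD:
  assumes "quasi_periodic c \<nu> \<Phi>"
  shows "\<Phi> x (y + 1) p = \<Phi> x y p"
    and "\<Phi> (x + 1) y p = ex (of_nat c * of_int p * (y - of_int p * \<nu>)) * \<Phi> x y p"
  using assms by (auto simp: quasi_periodic_def)

lemma D0_quasi_periodic:
  assumes "\<Phi> \<in> D0 c \<nu>"
  shows "quasi_periodic c \<nu> \<Phi>"
  unfolding quasi_periodic_def
proof (intro allI conjI)
  fix x y p
  show "\<Phi> x (y + 1) p = \<Phi> x y p"
    using assms by (auto simp: D0_def Cc_Z_CbM_def)
  let ?t = "of_nat c * of_int p * (y - of_int p * \<nu>)"
  have "\<Phi> (x + 1) y p = ex (?t + (- ?t)) * \<Phi> (x + 1) y p"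
    by simp
  also have "\<dots> = ex ?t * (cnj (ex ?t) * \<Phi> (x + 1) y p)"
    by (simp only: ex_add cnj_ex mult.assoc)
  also have "cnj (ex ?t) * \<Phi> (x + 1) y p = \<Phi> x y p"
  proof -
    have "\<forall>(k::int) x y p.
     cnj (ex (of_nat c * of_int k * of_int p * (y - of_int p * \<nu>))) * \<Phi> (x + of_int k) y p
       = \<Phi> x y p"
      using assms by (simp add: D0_def)
    from this[rule_format, of 1 p y x] show ?thesis by simp
  qed
  finally show "\<Phi> (x + 1) y p = ex ?t * \<Phi> x y p" .
qed

text \<open>The phases form a cocycle: \<open>q^2\<close>, \<open>2q(p - q)\<close> and
  \<open>(p - q)^2\<close> add up to \<open>p^2\<close>, so each term of the sum acquires the same
  phase.\<close>

lemma quasi_periodic_cp_prod: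
  assumes \<Phi>: "quasi_periodic c \<nu> \<Phi>" and \<Psi>: "quasi_periodic c \<nu> \<Psi>"
  shows "quasi_periodic c \<nu> (cp_prod \<mu> \<nu> \<Phi> \<Psi>)"
  unfolding quasi_periodic_def
proof (intro allI conjI)
  fix x y p
  have "\<Psi> s (y + 1 - t) r = \<Psi> s (y - t) r" for s t r
    using quasi_periodicD(1)[OF \<Psi>, of s "y - t" r] by (simp add: algebra_simps)
  then show "cp_prod \<mu> \<nu> \<Phi> \<Psi> x (y + 1) p = cp_prod \<mu> \<nu> \<Phi> \<Psi> x y p"
    by (simp add: cp_prod_def quasi_periodicD[OF \<Phi>])
  have "\<Phi> (x + 1) y q * \<Psi> (x + 1 - 2 * of_int q * \<mu>) (y - 2 * of_int q * \<nu>) (p - q)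
      = ex (of_nat c * of_int p * (y - of_int p * \<nu>))
        * (\<Phi> x y q * \<Psi> (x - 2 * of_int q * \<mu>) (y - 2 * of_int q * \<nu>) (p - q))" for q
  proof -
    let ?s = "of_nat c * of_int q * (y - of_int q * \<nu>)"
    let ?t = "of_nat c * of_int (p - q) * (y - 2 * of_int q * \<nu> - of_int (p - q) * \<nu>)"
    have "x + 1 - 2 * of_int q * \<mu> = (x - 2 * of_int q * \<mu>) + 1" by simp
    moreover have "of_nat c * of_int p * (y - of_int p * \<nu>) = ?s + ?t"
      by (simp add: algebra_simps)
    ultimately show ?thesis
      by (simp only: quasi_periodicD(2)[OF \<Phi>] quasi_periodicD(2)[OF \<Psi>] ex_add mult_ac)
  qed
  then show "cp_prod \<mu> \<nu> \<Phi> \<Psi> (x + 1) y p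
      = ex (of_nat c * of_int p * (y - of_int p * \<nu>)) * cp_prod \<mu> \<nu> \<Phi> \<Psi> x y p"
    by (simp add: cp_prod_def infsum_cmult_right')
qed

text \<open>Norm approximation from \<open>D0\<close> implies pointwise convergence of coefficients,
  enough to carry over equivariance and measurability.\<close>

lemma QHM_approx:
  assumes "\<Phi> \<in> QHM c \<mu> \<nu>"
  obtains f where "\<And>n::nat. f n \<in> D0 c \<nu>" "\<And>x y p. (\<lambda>n. f n x y p) \<longlonglongrightarrow> \<Phi> x y p"
proof -
  have "\<exists>\<Psi>\<in>D0 c \<nu>. \<Phi> - \<Psi> \<in> reg_bounded \<mu> \<nu> \<and> cp_norm \<mu> \<nu> (\<Phi> - \<Psi>) < inverse (real (Suc n))" for n
    using assms unfolding QHM_def cp_closure_def by auto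
  then obtain f where f: "\<And>n. f n \<in> D0 c \<nu>" "\<And>n. \<Phi> - f n \<in> reg_bounded \<mu> \<nu>"
      "\<And>n. cp_norm \<mu> \<nu> (\<Phi> - f n) < inverse (real (Suc n))"
    by metis
  have "(\<lambda>n. f n x y p) \<longlonglongrightarrow> \<Phi> x y p" for x y p
  proof (rule LIM_zero_cancel, rule Lim_null_comparison[OF _ LIMSEQ_inverse_real_of_nat],
      rule always_eventually, rule allI)
    fix n
    show "cmod (f n x y p - \<Phi> x y p) \<le> inverse (real (Suc n))"
      using cp_norm_less_imp_coeff_less[OF f(2,3), of n x y p] by (simp add: norm_minus_commute)
  qed
  with f(1) show ?thesis by (rule that)
qed

lemma QHM_reg_bounded: "\<Phi> \<in> QHM c \<mu> \<nu> \<Longrightarrow> \<Phi> \<in> reg_bounded \<mu> \<nu>"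
  by (simp add: QHM_def cp_closure_def)

lemma QHM_quasi_periodic:
  assumes "\<Phi> \<in> QHM c \<mu> \<nu>"
  shows "quasi_periodic c \<nu> \<Phi>"
proof -
  obtain f where f: "\<And>n::nat. f n \<in> D0 c \<nu>" "\<And>x y p. (\<lambda>n. f n x y p) \<longlonglongrightarrow> \<Phi> x y p"
    using QHM_approx[OF assms] by blast
  note q = quasi_periodicD[OF D0_quasi_periodic[OF f(1)]]
  show ?thesis
    unfolding quasi_periodic_def
  proof (intro allI conjI)
    fix x y p
    show "\<Phi> x (y + 1) p = \<Phi> x y p"
      using LIMSEQ_unique[OF f(2)[of x "y + 1" p]] f(2)[of x y p] by (simp add: q)
    show "\<Phi> (x + 1) y p = ex (of_nat c * of_int p * (y - of_int p * \<nu>)) * \<Phi> x y p"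
      using LIMSEQ_unique[OF f(2)[of "x + 1" y p]] tendsto_mult_left[OF f(2)[of x y p]]
      by (simp add: q)
  qed
qed

text \<open>Borel measurability, rather than continuity, is tracked because it passes directly to
  pointwise limits and to the infinite sums in \<open>cp_prod\<close>.\<close>

definition coeffs_measurable :: "cfun \<Rightarrow> bool" where
  "coeffs_measurable \<Phi> \<longleftrightarrow> (\<forall>p. (\<lambda>m. \<Phi> (fst m) (snd m) p) \<in> borel_measurable borel)"

lemma QHM_coeffs_measurable:
  assumes "\<Phi> \<in> QHM c \<mu> \<nu>"
  shows "coeffs_measurable \<Phi>"
proof -
  obtain f where f: "\<And>n::nat. f n \<in> D0 c \<nu>" "\<And>x y p. (\<lambda>n. f n x y p) \<longlonglongrightarrow> \<Phi> x y p"
    using QHM_approx[OF assms] by blast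
  have "(\<lambda>m. f n (fst m) (snd m) p) \<in> borel_measurable borel" for n p
    using f(1)[of n]
    by (intro borel_measurable_continuous_onI) (simp add: D0_def Cc_Z_CbM_def case_prod_unfold)
  then show ?thesis
    unfolding coeffs_measurable_def
    by (intro allI) (rule borel_measurable_LIMSEQ_metric[OF _ f(2)])
qed

section \<open>Derivatives along orbits of the Heisenberg action\<close>

lemma has_vector_derivative_iff_quotient:
  fixes g :: "real \<Rightarrow> complex"
  shows "(g has_vector_derivative d) (at t) \<longleftrightarrow>
    ((\<lambda>u. of_real (1 / u) * (g (t + u) - g t)) \<longlongrightarrow> d) (at 0)"
proof -
  have "\<forall>\<^sub>F u in at 0. norm (g (t + u) - g t - u *\<^sub>R d) / norm u
      = norm (of_real (1 / u) * (g (t + u) - g t) - d)"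
  proof (rule eventually_mono[OF eventually_at_filter[THEN iffD2, OF always_eventually]])
    fix u :: real
    assume "u \<noteq> 0"
    then have "of_real (1 / u) * (g (t + u) - g t) - d = (1 / u) *\<^sub>R (g (t + u) - g t - u *\<^sub>R d)"
      by (simp add: scaleR_conv_of_real field_simps)
    then show "norm (g (t + u) - g t - u *\<^sub>R d) / norm u
      = norm (of_real (1 / u) * (g (t + u) - g t) - d)"
      by simp
  qed auto
  then have "(\<lambda>u. norm (g (t + u) - g t - u *\<^sub>R d) / norm u) \<midarrow>0\<rightarrow> 0
      \<longleftrightarrow> (\<lambda>u. norm (of_real (1 / u) * (g (t + u) - g t) - d)) \<midarrow>0\<rightarrow> 0"
    by (rule tendsto_cong)
  then show ?thesis
    by (simp add: has_vector_derivative_def has_derivative_at bounded_linear_scaleR_left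
        tendsto_norm_zero_iff LIM_zero_iff)
qed

lemma has_vector_derivative_ex:
  "((\<lambda>u. ex (a * u)) has_vector_derivative 2 * of_real pi * \<i> * of_real a) (at 0)"
proof -
  have "((\<lambda>z. exp (2 * of_real pi * \<i> * of_real a * z)) has_field_derivative
      2 * of_real pi * \<i> * of_real a) (at (of_real 0))"
    by (auto intro!: derivative_eq_intros)
  from has_vector_derivative_real_field[OF this] show ?thesis
    by (simp add: ex_def mult.assoc)
qed

text \<open>The norm derivative of the orbit at the group identity lies in \<open>QHM\<close>; since
  the norm dominates coefficients, it is also the derivative coefficient by coefficient.\<close>

lemma QHM_smooth_derivative:
  assumes "P \<in> QHM_smooth c \<mu> \<nu>" "b \<in> Basis"
  obtains A where "A \<in> QHM c \<mu> \<nu>"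
    "\<And>x y p. ((\<lambda>u. heis_act c \<mu> (u *\<^sub>R b) P x y p) has_vector_derivative A x y p) (at 0)"
proof -
  let ?F = "\<lambda>h. heis_act c \<mu> h P"
  have "QHM_Cn c \<mu> \<nu> (Suc 0) ?F"
    using assms(1) unfolding QHM_smooth_def by blast
  then have F: "\<And>h. ?F h \<in> QHM c \<mu> \<nu>"
    and "\<exists>G. QHM_partial \<mu> \<nu> b ?F G \<and> QHM_continuous c \<mu> \<nu> G"
    using assms(2) unfolding QHM_Cn.simps QHM_continuous_def[of c \<mu> \<nu> ?F] by blast+
  then obtain G where G: "QHM_partial \<mu> \<nu> b ?F G" "\<And>h. G h \<in> QHM c \<mu> \<nu>"
    unfolding QHM_continuous_def by blast
  have "((\<lambda>u. cscale (of_real (1 / u)) (?F (0 + u *\<^sub>R b) - ?F 0) x y p) \<longlongrightarrow> G 0 x y p) (at 0)" for x y p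
  proof (rule cp_norm_tendsto_imp_coeff_tendsto)
    show "cscale (of_real (1 / u)) (?F (0 + u *\<^sub>R b) - ?F 0) - G 0 \<in> reg_bounded \<mu> \<nu>" for u :: real
      by (intro reg_bounded_diff reg_bounded_cscale QHM_reg_bounded[of _ c] F G)
    show "((\<lambda>u::real. cp_norm \<mu> \<nu> (cscale (of_real (1 / u)) (?F (0 + u *\<^sub>R b) - ?F 0) - G 0)) \<longlongrightarrow> 0) (at 0)"
      using G(1) unfolding QHM_partial_def by blast
  qed
  then have "((\<lambda>u. ?F (u *\<^sub>R b) x y p) has_vector_derivative G 0 x y p) (at 0)" for x y p
    unfolding has_vector_derivative_iff_quotient by (simp add: cscale_def)
  with G(2) show ?thesis by (rule that)
qed

text \<open>The shift of \<open>x\<close> by \<open>2 p \<mu>\<close> in the involution turns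
  \<open>x - r + p \<mu>\<close> into \<open>x - r - p \<mu>\<close>, and conjugation undoes the
  sign change of \<open>p\<close> in the phase.\<close>

lemma cp_star_heis_act: "cp_star \<mu> \<nu> (heis_act c \<mu> h \<Phi>) = heis_act c \<mu> h (cp_star \<mu> \<nu> \<Phi>)"
proof (intro ext)
  fix x y p
  obtain r s t where h: "h = (r, s, t)" by (cases h)
  show "cp_star \<mu> \<nu> (heis_act c \<mu> h \<Phi>) x y p = heis_act c \<mu> h (cp_star \<mu> \<nu> \<Phi>) x y p"
    by (simp add: h cp_star_def heis_act_def cnj_ex algebra_simps)
qed

text \<open>The orbit of a self-adjoint element is self-adjoint, so its derivative and the adjoint
  of its derivative are derivatives of the same functions.\<close>

lemma cp_star_derivative:
  assumes "cp_star \<mu> \<nu> P = P"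
    and A: "\<And>x y p. ((\<lambda>u. heis_act c \<mu> (u *\<^sub>R b) P x y p) has_vector_derivative A x y p) (at 0)"
  shows "cp_star \<mu> \<nu> A = A"
proof (intro ext)
  fix x y p
  have "((\<lambda>u. cp_star \<mu> \<nu> (heis_act c \<mu> (u *\<^sub>R b) P) x y p) has_vector_derivative cp_star \<mu> \<nu> A x y p) (at 0)"
    unfolding cp_star_def by (intro has_vector_derivative_cnj A)
  then have "((\<lambda>u. heis_act c \<mu> (u *\<^sub>R b) P x y p) has_vector_derivative cp_star \<mu> \<nu> A x y p) (at 0)"
    by (simp add: cp_star_heis_act assms(1))
  then show "cp_star \<mu> \<nu> A x y p = A x y p"
    using A vector_derivative_unique_at by blast
qed

text \<open>The action moves the argument backwards, to \<open>t - u\<close>; this is the source of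
  the minus signs in \<open>deltaX\<close> and \<open>deltaY\<close>.\<close>

lemma vector_derivative_reflect:
  fixes f :: "real \<Rightarrow> complex"
  assumes "((\<lambda>u. f (t - u)) has_vector_derivative d) (at 0)"
  shows "vector_derivative f (at t) = - d"
proof -
  have "((\<lambda>s. t - s) has_vector_derivative - 1) (at t)"
    by (auto intro!: derivative_eq_intros)
  from vector_diff_chain_at[OF this, of "\<lambda>u. f (t - u)" d] assms
  have "(f has_vector_derivative - d) (at t)"
    by (simp add: o_def)
  then show ?thesis by (rule vector_derivative_at)
qed

lemma deltaY_eq:
  assumes "\<And>x y p. ((\<lambda>u. heis_act c \<mu> (u *\<^sub>R (1, 0, 0)) P x y p) has_vector_derivative A x y p) (at 0)"
  shows "delta c \<mu> hY P = A"
proof (intro ext)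
  fix x y p
  have "((\<lambda>u. P (x - u) y p) has_vector_derivative A x y p) (at 0)"
    using assms[of x y p] by (simp add: heis_act_def)
  from vector_derivative_reflect[of "\<lambda>x. P x y p", OF this] show "delta c \<mu> hY P x y p = A x y p"
    by (simp add: delta_def hY_def deltaY_def cscale_def)
qed

lemma deltaZ_eq:
  assumes "\<And>x y p. ((\<lambda>u. heis_act c \<mu> (u *\<^sub>R (0, 0, 1)) P x y p) has_vector_derivative A x y p) (at 0)"
  shows "delta c \<mu> hZ P = A"
proof (intro ext)
  fix x y p
  have "((\<lambda>u. ex (of_int p * u) * P x y p) has_vector_derivative A x y p) (at 0)"
    using assms[of x y p] by (simp add: heis_act_def)
  moreover have "((\<lambda>u. ex (of_int p * u) * P x y p) has_vector_derivative
      2 * of_real pi * \<i> * of_real (of_int p) * P x y p) (at 0)"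
    by (intro has_vector_derivative_mult_left has_vector_derivative_ex)
  ultimately have "A x y p = 2 * of_real pi * \<i> * of_real (of_int p) * P x y p"
    by (rule vector_derivative_unique_at)
  then show "delta c \<mu> hZ P x y p = A x y p"
    by (simp add: delta_def hZ_def deltaZ_def cscale_def)
qed

text \<open>Differentiability of \<open>P\<close> in \<open>y\<close> has to be deduced from that of
  the orbit. Multiplying by the inverse phase isolates \<open>P x (y - u) p\<close>, and the product
  rule produces the term in \<open>?a\<close> that \<open>deltaX\<close> restores.\<close>

lemma deltaX_eq:
  assumes "\<And>x y p. ((\<lambda>u. heis_act c \<mu> (u *\<^sub>R (0, 1, 0)) P x y p) has_vector_derivative A x y p) (at 0)"
  shows "delta c \<mu> hX P = A"
proof (intro ext)
  fix x y p
  let ?a = "of_nat c * of_int p * (x - of_int p * \<mu>)"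
  have A: "((\<lambda>u. ex (?a * u) * P x (y - u) p) has_vector_derivative A x y p) (at 0)"
    using assms[of x y p] by (simp add: heis_act_def mult_ac)
  have "((\<lambda>u. ex (- ?a * u) * (ex (?a * u) * P x (y - u) p)) has_vector_derivative
      ex (- ?a * 0) * A x y p + 2 * of_real pi * \<i> * of_real (- ?a) * (ex (?a * 0) * P x (y - 0) p)) (at 0)"
    by (intro has_vector_derivative_mult A has_vector_derivative_ex)
  moreover have "(\<lambda>u. ex (- ?a * u) * (ex (?a * u) * P x (y - u) p)) = (\<lambda>u. P x (y - u) p)"
    by (rule ext) (simp only: mult.assoc[symmetric] ex_add[symmetric], simp)
  ultimately have "((\<lambda>u. P x (y - u) p) has_vector_derivative
      ex (- ?a * 0) * A x y p + 2 * of_real pi * \<i> * of_real (- ?a) * (ex (?a * 0) * P x (y - 0) p)) (at 0)"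
    by (simp only:)
  then have "((\<lambda>u. P x (y - u) p) has_vector_derivative
      A x y p - 2 * of_real pi * \<i> * of_real ?a * P x y p) (at 0)"
    by simp
  from vector_derivative_reflect[of "\<lambda>y. P x y p", OF this] show "delta c \<mu> hX P x y p = A x y p"
    by (simp add: delta_def hX_def deltaX_def cscale_def)
qed

text \<open>\<open>delta\<close> is built from the total operator \<open>vector_derivative\<close>.
  Identifying it with a norm derivative of the orbit is what gives membership in \<open>QHM\<close>
  and self-adjointness.\<close>

lemma delta_QHM:
  assumes "P \<in> QHM_smooth c \<mu> \<nu>" "cp_star \<mu> \<nu> P = P" "V \<in> {hX, hY, hZ}"
  shows "delta c \<mu> V P \<in> QHM c \<mu> \<nu>" and "cp_star \<mu> \<nu> (delta c \<mu> V P) = delta c \<mu> V P"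
proof -
  \<comment> \<open>One argument for all three directions; \<open>eq\<close> stands for whichever of
    \<open>deltaX_eq\<close>, \<open>deltaY_eq\<close>, \<open>deltaZ_eq\<close> fits.\<close>
  have "\<exists>A\<in>QHM c \<mu> \<nu>. delta c \<mu> V P = A \<and> cp_star \<mu> \<nu> A = A"
    if "b \<in> Basis" and eq: "\<And>A. (\<And>x y p. ((\<lambda>u. heis_act c \<mu> (u *\<^sub>R b) P x y p)
      has_vector_derivative A x y p) (at 0)) \<Longrightarrow> delta c \<mu> V P = A" for V b
  proof -
    obtain A where A: "A \<in> QHM c \<mu> \<nu>"
      "\<And>x y p. ((\<lambda>u. heis_act c \<mu> (u *\<^sub>R b) P x y p) has_vector_derivative A x y p) (at 0)"
      using QHM_smooth_derivative[OF assms(1) \<open>b \<in> Basis\<close>] by blast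
    show ?thesis
      using A(1) eq[OF A(2)] cp_star_derivative[OF assms(2) A(2)] by blast
  qed
  note * = this
  have "(0, 1, 0) \<in> (Basis :: (real \<times> real \<times> real) set)"
      "(1, 0, 0) \<in> (Basis :: (real \<times> real \<times> real) set)"
      "(0, 0, 1) \<in> (Basis :: (real \<times> real \<times> real) set)"
    by (simp_all add: Basis_prod_def zero_prod_def)
  then have "\<exists>A\<in>QHM c \<mu> \<nu>. delta c \<mu> V P = A \<and> cp_star \<mu> \<nu> A = A"
    using assms(3) *[OF _ deltaX_eq] *[OF _ deltaY_eq] *[OF _ deltaZ_eq] by blast
  then show "delta c \<mu> V P \<in> QHM c \<mu> \<nu>" and "cp_star \<mu> \<nu> (delta c \<mu> V P) = delta c \<mu> V P"
    by auto
qed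

section \<open>Measurability and the trace\<close>

text \<open>Enumerating the integers by \<open>int_decode\<close> opens the way to limit theorems
  for sequences and series.\<close>

lemma infsum_int_sums:
  fixes f :: "int \<Rightarrow> 'a::{topological_comm_monoid_add, t2_space}"
  assumes "(f has_sum s) UNIV"
  shows "(\<lambda>n. f (int_decode n)) sums s"
  by (rule has_sum_imp_sums) (use assms has_sum_reindex_bij_betw[OF bij_int_decode] in blast)

lemma borel_measurable_infsum_int:
  fixes f :: "int \<Rightarrow> 'a \<Rightarrow> 'b::{real_normed_vector, second_countable_topology}"
  assumes [measurable]: "\<And>q. f q \<in> borel_measurable M"
    and s: "\<And>m. (\<lambda>q. f q m) summable_on UNIV"
  shows "(\<lambda>m. \<Sum>\<^sub>\<infinity>q\<in>UNIV. f q m) \<in> borel_measurable M"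
proof (rule borel_measurable_LIMSEQ_metric)
  show "(\<lambda>m. \<Sum>i<n. f (int_decode i) m) \<in> borel_measurable M" for n
    by measurable
  show "(\<lambda>n. \<Sum>i<n. f (int_decode i) m) \<longlonglongrightarrow> (\<Sum>\<^sub>\<infinity>q\<in>UNIV. f q m)" for m
    using infsum_int_sums[OF has_sum_infsum[OF s]] by (simp add: sums_def)
qed

lemma borel_measurable_translate:
  fixes f :: "real \<times> real \<Rightarrow> 'b::topological_space"
  assumes "f \<in> borel_measurable borel"
  shows "(\<lambda>m. f (fst m + a, snd m + b)) \<in> borel_measurable borel"
proof -
  have "(\<lambda>m::real \<times> real. (fst m + a, snd m + b)) \<in> borel_measurable borel"
    by (intro borel_measurable_continuous_onI continuous_intros)
  from measurable_compose[OF this assms] show ?thesis .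
qed

lemma coeffs_measurable_translate:
  assumes "coeffs_measurable \<Phi>"
  shows "(\<lambda>m. \<Phi> (fst m + a) (snd m + b) p) \<in> borel_measurable borel"
  using borel_measurable_translate[of "\<lambda>m. \<Phi> (fst m) (snd m) p" a b] assms
  by (simp add: coeffs_measurable_def)

lemma cp_prod_summable:
  assumes "\<Phi> \<in> reg_bounded \<mu> \<nu>" "\<Psi> \<in> reg_bounded \<mu> \<nu>"
  shows "(\<lambda>q. \<Phi> x y q * \<Psi> (x - 2 * of_int q * \<mu>) (y - 2 * of_int q * \<nu>) (p - q)) summable_on UNIV"
proof -
  obtain C where "C \<ge> 0" and C: "\<And>x y. mat_bound (reg_mat \<mu> \<nu> \<Phi> x y) C"
    using reg_boundedE[OF assms(1)] by blast
  let ?x = "x - 2 * of_int p * \<mu>" and ?y = "y - 2 * of_int p * \<nu>"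
  have "(\<lambda>r. reg_mat \<mu> \<nu> \<Phi> ?x ?y p r * reg_col \<mu> \<nu> \<Psi> ?x ?y r) summable_on UNIV"
    by (rule mat_boundD(2)[OF C reg_col_in_l2[OF assms(2)]])
  then have "(\<lambda>q. reg_mat \<mu> \<nu> \<Phi> ?x ?y p (p - q) * reg_col \<mu> \<nu> \<Psi> ?x ?y (p - q)) summable_on UNIV"
    by (subst summable_on_reindex_bij_betw[OF bij_int_diff])
  then show ?thesis
    by (simp add: reg_mat_def reg_col_def algebra_simps)
qed

lemma coeffs_measurable_cp_prod:
  assumes \<Phi>: "\<Phi> \<in> reg_bounded \<mu> \<nu>" "coeffs_measurable \<Phi>"
    and \<Psi>: "\<Psi> \<in> reg_bounded \<mu> \<nu>" "coeffs_measurable \<Psi>"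
  shows "coeffs_measurable (cp_prod \<mu> \<nu> \<Phi> \<Psi>)"
  unfolding coeffs_measurable_def cp_prod_def
proof (intro allI borel_measurable_infsum_int cp_prod_summable \<Phi> \<Psi> borel_measurable_times)
  show "(\<lambda>m. \<Phi> (fst m) (snd m) q) \<in> borel_measurable borel" for q
    using \<Phi>(2) by (simp add: coeffs_measurable_def)
  show "(\<lambda>m. \<Psi> (fst m - 2 * of_int q * \<mu>) (snd m - 2 * of_int q * \<nu>) (p - q)) \<in> borel_measurable borel"
    for p q
    using coeffs_measurable_translate[OF \<Psi>(2), of "- (2 * of_int q * \<mu>)" "- (2 * of_int q * \<nu>)"] by simp
qed

lemma reg_col_coeffs_measurable:
  assumes "coeffs_measurable \<Phi>"
  shows "(\<lambda>m. (cmod (reg_col \<mu> \<nu> \<Phi> (fst m) (snd m) p))\<^sup>2) \<in> borel_measurable borel"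
  unfolding reg_col_def
  using coeffs_measurable_translate[OF assms] by measurable

lemma l2_norm_reg_col_measurable:
  assumes "coeffs_measurable \<Phi>" "\<And>x y. reg_col \<mu> \<nu> \<Phi> x y \<in> l2"
  shows "(\<lambda>m. (l2_norm (reg_col \<mu> \<nu> \<Phi> (fst m) (snd m)))\<^sup>2) \<in> borel_measurable borel"
  unfolding l2_norm_power2
  by (intro borel_measurable_infsum_int reg_col_coeffs_measurable assms l2_summable)

abbreviation unit_square :: "(real \<times> real) set" where
  "unit_square \<equiv> cbox (0, 0) (1, 1)"

text \<open>Links the gauge integral in \<open>tauD\<close> with the nonnegative Lebesgue integral,
  where sums and integrals may be interchanged freely.\<close>

lemma bounded_borel_integral:
  fixes g :: "real \<times> real \<Rightarrow> real"
  assumes [measurable]: "g \<in> borel_measurable borel" and g: "\<And>m. 0 \<le> g m" "\<And>m. g m \<le> B"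
  shows "g integrable_on unit_square"
    and "(\<integral>\<^sup>+m. ennreal (g m) * indicator unit_square m \<partial>lborel) = ennreal (integral unit_square g)"
proof -
  have "integrable lborel (\<lambda>m. indicator unit_square m *\<^sub>R g m)"
  proof (rule integrableI_bounded_set_indicator)
    show "emeasure lborel unit_square < \<infinity>"
      by (rule emeasure_lborel_cbox_finite)
    show "AE m in lborel. m \<in> unit_square \<longrightarrow> norm (g m) \<le> B"
      using g by simp
  qed auto
  then have s: "set_integrable lborel unit_square g"
    by (simp add: set_integrable_def)
  from set_borel_integral_eq_integral(1)[OF s] show "g integrable_on unit_square" .
  have "(\<integral>\<^sup>+m. ennreal (g m) * indicator unit_square m \<partial>lborel)
      = (\<integral>\<^sup>+m. ennreal (indicator unit_square m *\<^sub>R g m) \<partial>lborel)"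
    by (intro nn_integral_cong) (simp add: indicator_def)
  also have "\<dots> = ennreal (LINT m:unit_square|lborel. g m)"
    unfolding set_lebesgue_integral_def
    using s[unfolded set_integrable_def] by (intro nn_integral_eq_integral) (auto simp: g)
  also have "\<dots> = ennreal (integral unit_square g)"
    by (simp add: set_borel_integral_eq_integral(2)[OF s])
  finally show "(\<integral>\<^sup>+m. ennreal (g m) * indicator unit_square m \<partial>lborel) = ennreal (integral unit_square g)" .
qed

section \<open>Translation invariance of integrals over the torus\<close>

lemma periodic_of_int:
  fixes g :: "real \<Rightarrow> 'a"
  assumes "\<And>x. g (x + 1) = g x"
  shows "g (x + of_int k) = g x"
proof (induction k arbitrary: x rule: int_induct[where k = 0])
  case (step1 i)
  then show ?case using assms[of "x + of_int i"] by (simp add: add.assoc)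
next
  case (step2 i)
  then show ?case using assms[of "x + of_int (i - 1)"] by simp
qed simp

text \<open>With \<open>a\<close> replaced by its fractional part \<open>f\<close>, the interval
  from \<open>f\<close> to \<open>1 + f\<close> is cut at 1 and the upper piece moved down by one
  period. Half-open intervals make the cuts exact.\<close>

lemma nn_integral_periodic_translate_Ico:
  fixes g :: "real \<Rightarrow> ennreal"
  assumes [measurable]: "g \<in> borel_measurable borel" and per: "\<And>x. g (x + 1) = g x"
  shows "(\<integral>\<^sup>+x. g (x + a) * indicator {0..<1} x \<partial>lborel) = (\<integral>\<^sup>+x. g x * indicator {0..<1} x \<partial>lborel)"
proof -
  define f where "f = frac a"
  have f: "0 \<le> f" "f < 1"
    by (auto simp: f_def frac_lt_1)
  have g: "g (x + a) = g (x + f)" for x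
    using periodic_of_int[of g "x + f" "\<lfloor>a\<rfloor>", OF per] by (simp add: f_def frac_def algebra_simps)
  have "(\<integral>\<^sup>+x. g (x + a) * indicator {0..<1} x \<partial>lborel) = (\<integral>\<^sup>+x. g (f + 1 * x) * indicator {f..<1 + f} (f + 1 * x) \<partial>lborel)"
    by (intro nn_integral_cong) (auto simp: g add.commute indicator_def)
  also have "\<dots> = (\<integral>\<^sup>+x. g x * indicator {f..<1 + f} x \<partial>lborel)"
    using nn_integral_real_affine[of "\<lambda>x. g x * indicator {f..<1 + f} x" 1 f] by simp
  also have "\<dots> = (\<integral>\<^sup>+x. g x * indicator {f..<1} x + g x * indicator {1..<1 + f} x \<partial>lborel)"
    using f by (intro nn_integral_cong) (auto simp: indicator_def)
  also have "\<dots> = (\<integral>\<^sup>+x. g x * indicator {f..<1} x \<partial>lborel) + (\<integral>\<^sup>+x. g x * indicator {1..<1 + f} x \<partial>lborel)"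
    by (rule nn_integral_add) auto
  also have "(\<integral>\<^sup>+x. g x * indicator {1..<1 + f} x \<partial>lborel)
      = (\<integral>\<^sup>+x. g (1 + 1 * x) * indicator {1..<1 + f} (1 + 1 * x) \<partial>lborel)"
    using nn_integral_real_affine[of "\<lambda>x. g x * indicator {1..<1 + f} x" 1 1] by simp
  also have "\<dots> = (\<integral>\<^sup>+x. g x * indicator {0..<f} x \<partial>lborel)"
    using per by (intro nn_integral_cong) (auto simp: indicator_def add.commute)
  also have "(\<integral>\<^sup>+x. g x * indicator {f..<1} x \<partial>lborel) + (\<integral>\<^sup>+x. g x * indicator {0..<f} x \<partial>lborel)
      = (\<integral>\<^sup>+x. g x * indicator {f..<1} x + g x * indicator {0..<f} x \<partial>lborel)"
    by (rule nn_integral_add[symmetric]) auto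
  also have "\<dots> = (\<integral>\<^sup>+x. g x * indicator {0..<1} x \<partial>lborel)"
    using f by (intro nn_integral_cong) (auto simp: indicator_def)
  finally show ?thesis .
qed

lemma nn_integral_periodic_translate:
  fixes g :: "real \<Rightarrow> ennreal"
  assumes "g \<in> borel_measurable borel" and "\<And>x. g (x + 1) = g x"
  shows "(\<integral>\<^sup>+x. g (x + a) * indicator {0..1} x \<partial>lborel) = (\<integral>\<^sup>+x. g x * indicator {0..1} x \<partial>lborel)"
proof -
  \<comment> \<open>The closed interval differs from the half-open one by the null set
    \<open>{1}\<close>.\<close>
  have "(\<integral>\<^sup>+x. h x * indicator {0..1} x \<partial>lborel) = (\<integral>\<^sup>+x. h x * indicator {0..<1} x \<partial>lborel)"
    for h :: "real \<Rightarrow> ennreal"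
    by (intro nn_integral_cong_AE eventually_mono[OF AE_lborel_singleton[of 1]])
      (auto simp: indicator_def)
  then show ?thesis
    using nn_integral_periodic_translate_Ico[OF assms] by simp
qed

lemma nn_integral_unit_square:
  fixes g :: "real \<times> real \<Rightarrow> ennreal"
  assumes "g \<in> borel_measurable borel"
  shows "(\<integral>\<^sup>+m. g m * indicator unit_square m \<partial>lborel)
    = (\<integral>\<^sup>+x. (\<integral>\<^sup>+y. g (x, y) * indicator {0..1} y \<partial>lborel) * indicator {0..1} x \<partial>lborel)"
proof -
  have g [measurable]: "g \<in> borel_measurable (borel \<Otimes>\<^sub>M borel)"
    using assms by (simp add: borel_prod)
  have m: "(\<lambda>m. g m * indicator unit_square m) \<in> borel_measurable (lborel \<Otimes>\<^sub>M lborel)"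
    unfolding lborel_prod using assms by simp
  have "(\<integral>\<^sup>+m. g m * indicator unit_square m \<partial>lborel)
      = (\<integral>\<^sup>+x. \<integral>\<^sup>+y. g (x, y) * indicator unit_square (x, y) \<partial>lborel \<partial>lborel)"
    using lborel.nn_integral_fst[OF m] by (simp add: lborel_prod)
  also have "\<dots> = (\<integral>\<^sup>+x. \<integral>\<^sup>+y. (g (x, y) * indicator {0..1} y) * indicator {0..1} x \<partial>lborel \<partial>lborel)"
    by (intro nn_integral_cong) (auto simp: indicator_def cbox_Pair_eq)
  also have "\<dots> = (\<integral>\<^sup>+x. (\<integral>\<^sup>+y. g (x, y) * indicator {0..1} y \<partial>lborel) * indicator {0..1} x \<partial>lborel)"
    by (intro nn_integral_cong nn_integral_multc) measurable
  finally show ?thesis .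
qed

text \<open>Tonelli reduces this to one coordinate at a time; the inner integral is again periodic
  in \<open>x\<close>.\<close>

lemma nn_integral_unit_square_translate:
  fixes g :: "real \<times> real \<Rightarrow> ennreal"
  assumes g: "g \<in> borel_measurable borel"
    and per: "\<And>x y. g (x + 1, y) = g (x, y)" "\<And>x y. g (x, y + 1) = g (x, y)"
  shows "(\<integral>\<^sup>+m. g (fst m + a, snd m + b) * indicator unit_square m \<partial>lborel)
    = (\<integral>\<^sup>+m. g m * indicator unit_square m \<partial>lborel)"
proof -
  have [measurable]: "g \<in> borel_measurable (borel \<Otimes>\<^sub>M borel)"
    using assms by (simp add: borel_prod)
  have 1: "(\<integral>\<^sup>+y. g (x, y + b) * indicator {0..1} y \<partial>lborel) = (\<integral>\<^sup>+y. g (x, y) * indicator {0..1} y \<partial>lborel)" for x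
    by (rule nn_integral_periodic_translate) (auto simp: per)
  have 2: "(\<integral>\<^sup>+x. (\<integral>\<^sup>+y. g (x + a, y) * indicator {0..1} y \<partial>lborel) * indicator {0..1} x \<partial>lborel)
      = (\<integral>\<^sup>+x. (\<integral>\<^sup>+y. g (x, y) * indicator {0..1} y \<partial>lborel) * indicator {0..1} x \<partial>lborel)"
    by (rule nn_integral_periodic_translate[of "\<lambda>x. \<integral>\<^sup>+y. g (x, y) * indicator {0..1} y \<partial>lborel"])
      (auto simp: per)
  show ?thesis
    unfolding nn_integral_unit_square[OF g]
      nn_integral_unit_square[OF borel_measurable_translate[OF g]]
    by (simp add: 1 2)
qed

text \<open>A uniform bound on column 0 stands in for membership of products in \<open>QHM\<close>:
  with measurability it makes the squared column norms integrable.\<close>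

lemma reg_col_cp_prod_bound:
  assumes "\<Phi> \<in> reg_bounded \<mu> \<nu>" "\<Psi> \<in> reg_bounded \<mu> \<nu>"
  obtains B where "\<And>x y. reg_col \<mu> \<nu> (cp_prod \<mu> \<nu> \<Phi> \<Psi>) x y \<in> l2"
    "\<And>x y. l2_norm (reg_col \<mu> \<nu> (cp_prod \<mu> \<nu> \<Phi> \<Psi>) x y) \<le> B"
proof -
  obtain C where C: "C \<ge> 0" "\<And>x y. mat_bound (reg_mat \<mu> \<nu> \<Phi> x y) C"
    using reg_boundedE[OF assms(1)] by blast
  obtain D where D: "D \<ge> 0" "\<And>x y. mat_bound (reg_mat \<mu> \<nu> \<Psi> x y) D"
    using reg_boundedE[OF assms(2)] by blast
  show ?thesis
  proof
    fix x y
    note l = reg_col_l2[OF D(2), of x y]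
    show "reg_col \<mu> \<nu> (cp_prod \<mu> \<nu> \<Phi> \<Psi>) x y \<in> l2"
      unfolding reg_col_cp_prod by (rule mat_boundD(3)[OF C(2) l(1)])
    show "l2_norm (reg_col \<mu> \<nu> (cp_prod \<mu> \<nu> \<Phi> \<Psi>) x y) \<le> C * D"
      unfolding reg_col_cp_prod
      using mat_boundD(4)[OF C(2) l(1), of x y] mult_left_mono[OF l(2) C(1)] by linarith
  qed
qed

text \<open>By \<open>cp_prod_flip\<close> the coefficients of \<open>AB\<close> at the fixed point
  \<open>(x, y)\<close> are the conjugated entries of column 0 of \<open>BA\<close> in reversed
  order.\<close>

lemma has_sum_cp_prod_flip:
  assumes A: "cp_star \<mu> \<nu> A = A" "A \<in> reg_bounded \<mu> \<nu>" and B: "cp_star \<mu> \<nu> B = B" "B \<in> reg_bounded \<mu> \<nu>"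
  shows "((\<lambda>p. (cmod (cp_prod \<mu> \<nu> A B x y p))\<^sup>2) has_sum
    (l2_norm (reg_col \<mu> \<nu> (cp_prod \<mu> \<nu> B A) x y))\<^sup>2) UNIV"
proof -
  let ?\<xi> = "reg_col \<mu> \<nu> (cp_prod \<mu> \<nu> B A) x y"
  have "?\<xi> \<in> l2"
    using reg_col_cp_prod_bound[OF B(2) A(2)] by metis
  then have "((\<lambda>p. (cmod (?\<xi> p))\<^sup>2) has_sum (l2_norm ?\<xi>)\<^sup>2) UNIV"
    unfolding l2_norm_power2 by (intro has_sum_infsum l2_summable)
  then have "((\<lambda>p. (cmod (?\<xi> (0 - p)))\<^sup>2) has_sum (l2_norm ?\<xi>)\<^sup>2) UNIV"
    by (subst has_sum_reindex_bij_betw[OF bij_int_diff])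
  moreover have "(cmod (cp_prod \<mu> \<nu> A B x y p))\<^sup>2 = (cmod (?\<xi> (0 - p)))\<^sup>2" for p
    by (subst cp_prod_flip[OF A(1) B(1)]) (simp add: reg_col_def)
  ultimately show ?thesis by simp
qed

text \<open>Since \<open>BA = (AB)\<^sup>*\<close>, this is the trace property.\<close>

lemma nn_integral_reg_col_flip:
  assumes A: "cp_star \<mu> \<nu> A = A" "A \<in> QHM c \<mu> \<nu>" and B: "cp_star \<mu> \<nu> B = B" "B \<in> QHM c \<mu> \<nu>"
  shows "(\<integral>\<^sup>+m. ennreal ((l2_norm (reg_col \<mu> \<nu> (cp_prod \<mu> \<nu> A B) (fst m) (snd m)))\<^sup>2) * indicator unit_square m \<partial>lborel)
    = (\<integral>\<^sup>+m. ennreal ((l2_norm (reg_col \<mu> \<nu> (cp_prod \<mu> \<nu> B A) (fst m) (snd m)))\<^sup>2) * indicator unit_square m \<partial>lborel)"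
proof -
  let ?AB = "cp_prod \<mu> \<nu> A B"
  note rb = QHM_reg_bounded[OF A(2)] QHM_reg_bounded[OF B(2)]
  have meas: "coeffs_measurable ?AB"
    by (intro coeffs_measurable_cp_prod rb QHM_coeffs_measurable[OF A(2)] QHM_coeffs_measurable[OF B(2)])
  have l2: "reg_col \<mu> \<nu> ?AB x y \<in> l2" for x y
    using reg_col_cp_prod_bound[OF rb] by metis
  have qp: "quasi_periodic c \<nu> ?AB"
    by (intro quasi_periodic_cp_prod QHM_quasi_periodic[OF A(2)] QHM_quasi_periodic[OF B(2)])
  have col: "ennreal ((l2_norm (reg_col \<mu> \<nu> ?AB x y))\<^sup>2)
      = (\<Sum>n. ennreal ((cmod (reg_col \<mu> \<nu> ?AB x y (int_decode n)))\<^sup>2))" for x y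
    unfolding l2_norm_power2
    by (intro suminf_ennreal_eq[symmetric] infsum_int_sums has_sum_infsum l2_summable l2) simp
  have flip: "ennreal ((l2_norm (reg_col \<mu> \<nu> (cp_prod \<mu> \<nu> B A) x y))\<^sup>2)
      = (\<Sum>n. ennreal ((cmod (?AB x y (int_decode n)))\<^sup>2))" for x y
    by (intro suminf_ennreal_eq[symmetric] infsum_int_sums has_sum_cp_prod_flip A(1) B(1) rb) simp
  have mp: "(\<lambda>m. ennreal ((cmod (?AB (fst m) (snd m) p))\<^sup>2)) \<in> borel_measurable borel" for p
    using meas[unfolded coeffs_measurable_def, rule_format, of p] by measurable
  \<comment> \<open>Column 0 reads coefficient \<open>p\<close> at a point translated by
    \<open>\<lambda>\<^sub>p\<close>. The modulus is periodic in both variables, so the integral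
    does not notice the translation; this invariance is the heart of the trace property.\<close>
  have shift: "(\<integral>\<^sup>+m. ennreal ((cmod (reg_col \<mu> \<nu> ?AB (fst m) (snd m) p))\<^sup>2) * indicator unit_square m \<partial>lborel)
      = (\<integral>\<^sup>+m. ennreal ((cmod (?AB (fst m) (snd m) p))\<^sup>2) * indicator unit_square m \<partial>lborel)" for p
    using nn_integral_unit_square_translate[OF mp, of p "2 * of_int p * \<mu>" "2 * of_int p * \<nu>"]
    by (simp add: reg_col_def quasi_periodicD[OF qp] norm_mult)
  have "(\<integral>\<^sup>+m. ennreal ((l2_norm (reg_col \<mu> \<nu> ?AB (fst m) (snd m)))\<^sup>2) * indicator unit_square m \<partial>lborel)
      = (\<integral>\<^sup>+m. (\<Sum>n. ennreal ((cmod (reg_col \<mu> \<nu> ?AB (fst m) (snd m) (int_decode n)))\<^sup>2) * indicator unit_square m) \<partial>lborel)"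
    by (simp add: col)
  also have "\<dots> = (\<Sum>n. \<integral>\<^sup>+m. ennreal ((cmod (reg_col \<mu> \<nu> ?AB (fst m) (snd m) (int_decode n)))\<^sup>2) * indicator unit_square m \<partial>lborel)"
    using reg_col_coeffs_measurable[OF meas] by (intro nn_integral_suminf) simp
  also have "\<dots> = (\<Sum>n. \<integral>\<^sup>+m. ennreal ((cmod (?AB (fst m) (snd m) (int_decode n)))\<^sup>2) * indicator unit_square m \<partial>lborel)"
    by (simp add: shift)
  also have "\<dots> = (\<integral>\<^sup>+m. (\<Sum>n. ennreal ((cmod (?AB (fst m) (snd m) (int_decode n)))\<^sup>2) * indicator unit_square m) \<partial>lborel)"
    using mp by (intro nn_integral_suminf[symmetric]) simp
  also have "\<dots> = (\<integral>\<^sup>+m. ennreal ((l2_norm (reg_col \<mu> \<nu> (cp_prod \<mu> \<nu> B A) (fst m) (snd m)))\<^sup>2) * indicator unit_square m \<partial>lborel)"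
    by (simp add: flip)
  finally show ?thesis .
qed

text \<open>The square of the trace norm \<open>\<parallel>\<Phi>\<parallel>\<close>, written
  through column norms so that it is real by construction and makes sense for products as
  well.\<close>

definition hs_norm_sq :: "real \<Rightarrow> real \<Rightarrow> cfun \<Rightarrow> real" where
  "hs_norm_sq \<mu> \<nu> \<Phi> = integral unit_square (\<lambda>m. (l2_norm (reg_col \<mu> \<nu> \<Phi> (fst m) (snd m)))\<^sup>2)"

lemma hs_norm_sq_nonneg: "hs_norm_sq \<mu> \<nu> \<Phi> \<ge> 0"
  unfolding hs_norm_sq_def
  \<comment> \<open>A non-integrable integrand has integral 0 by convention.\<close>
  by (cases "(\<lambda>m. (l2_norm (reg_col \<mu> \<nu> \<Phi> (fst m) (snd m)))\<^sup>2) integrable_on unit_square")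
    (auto intro: Henstock_Kurzweil_Integration.integral_nonneg simp: not_integrable_integral)

lemma l2_norm_reg_col_integral:
  assumes "coeffs_measurable \<Phi>" "\<And>x y. reg_col \<mu> \<nu> \<Phi> x y \<in> l2" "\<And>x y. l2_norm (reg_col \<mu> \<nu> \<Phi> x y) \<le> B"
  shows "(\<lambda>m. (l2_norm (reg_col \<mu> \<nu> \<Phi> (fst m) (snd m)))\<^sup>2) integrable_on unit_square"
    and "(\<integral>\<^sup>+m. ennreal ((l2_norm (reg_col \<mu> \<nu> \<Phi> (fst m) (snd m)))\<^sup>2) * indicator unit_square m \<partial>lborel)
      = ennreal (hs_norm_sq \<mu> \<nu> \<Phi>)"
  unfolding hs_norm_sq_def
  by (rule bounded_borel_integral[where B = "B\<^sup>2"];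
      simp add: l2_norm_reg_col_measurable assms power_mono l2_norm_nonneg)+

lemma QHM_l2_norm_reg_col_integral:
  assumes "\<Phi> \<in> QHM c \<mu> \<nu>"
  shows "(\<lambda>m. (l2_norm (reg_col \<mu> \<nu> \<Phi> (fst m) (snd m)))\<^sup>2) integrable_on unit_square"
    and "(\<integral>\<^sup>+m. ennreal ((l2_norm (reg_col \<mu> \<nu> \<Phi> (fst m) (snd m)))\<^sup>2) * indicator unit_square m \<partial>lborel)
      = ennreal (hs_norm_sq \<mu> \<nu> \<Phi>)"
proof -
  obtain C where "C \<ge> 0" and C: "\<And>x y. mat_bound (reg_mat \<mu> \<nu> \<Phi> x y) C"
    using reg_boundedE[OF QHM_reg_bounded[OF assms]] by blast
  note * = l2_norm_reg_col_integral[OF QHM_coeffs_measurable[OF assms] reg_col_l2[OF C]]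
  show "(\<lambda>m. (l2_norm (reg_col \<mu> \<nu> \<Phi> (fst m) (snd m)))\<^sup>2) integrable_on unit_square"
    and "(\<integral>\<^sup>+m. ennreal ((l2_norm (reg_col \<mu> \<nu> \<Phi> (fst m) (snd m)))\<^sup>2) * indicator unit_square m \<partial>lborel)
      = ennreal (hs_norm_sq \<mu> \<nu> \<Phi>)"
    by (fact *)+
qed

text \<open>The factors are swapped under the integral by the trace property, after which the
  fibrewise contraction by \<open>P\<close> applies to \<open>PA\<close>.\<close>

lemma hs_norm_sq_cp_prod_projection:
  assumes P: "QHM_projection \<mu> \<nu> P" "P \<in> QHM c \<mu> \<nu>" and A: "cp_star \<mu> \<nu> A = A" "A \<in> QHM c \<mu> \<nu>"
  shows "(\<lambda>m. (l2_norm (reg_col \<mu> \<nu> (cp_prod \<mu> \<nu> A P) (fst m) (snd m)))\<^sup>2) integrable_on unit_square"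
    and "hs_norm_sq \<mu> \<nu> (cp_prod \<mu> \<nu> A P) \<le> hs_norm_sq \<mu> \<nu> A"
proof -
  note rb = QHM_reg_bounded[OF A(2)] QHM_reg_bounded[OF P(2)]
  have P1: "cp_star \<mu> \<nu> P = P" using P(1) by (simp add: QHM_projection_def)
  obtain B where B: "\<And>x y. reg_col \<mu> \<nu> (cp_prod \<mu> \<nu> A P) x y \<in> l2"
      "\<And>x y. l2_norm (reg_col \<mu> \<nu> (cp_prod \<mu> \<nu> A P) x y) \<le> B"
    using reg_col_cp_prod_bound[OF rb] by blast
  have meas: "coeffs_measurable (cp_prod \<mu> \<nu> A P)"
    by (intro coeffs_measurable_cp_prod rb QHM_coeffs_measurable[OF A(2)] QHM_coeffs_measurable[OF P(2)])
  note AP = l2_norm_reg_col_integral[OF meas B]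
  show "(\<lambda>m. (l2_norm (reg_col \<mu> \<nu> (cp_prod \<mu> \<nu> A P) (fst m) (snd m)))\<^sup>2) integrable_on unit_square"
    by (fact AP(1))
  have "ennreal (hs_norm_sq \<mu> \<nu> (cp_prod \<mu> \<nu> A P))
      = (\<integral>\<^sup>+m. ennreal ((l2_norm (reg_col \<mu> \<nu> (cp_prod \<mu> \<nu> P A) (fst m) (snd m)))\<^sup>2) * indicator unit_square m \<partial>lborel)"
    unfolding AP(2)[symmetric] by (rule nn_integral_reg_col_flip[OF A P1 P(2)])
  also have "\<dots> \<le> (\<integral>\<^sup>+m. ennreal ((l2_norm (reg_col \<mu> \<nu> A (fst m) (snd m)))\<^sup>2) * indicator unit_square m \<partial>lborel)"
    by (intro nn_integral_mono mult_right_mono ennreal_leI power_mono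
        l2_norm_reg_col_projection_le P(1) rb l2_norm_nonneg) simp
  also have "\<dots> = ennreal (hs_norm_sq \<mu> \<nu> A)"
    by (rule QHM_l2_norm_reg_col_integral(2)[OF A(2)])
  finally show "hs_norm_sq \<mu> \<nu> (cp_prod \<mu> \<nu> A P) \<le> hs_norm_sq \<mu> \<nu> A"
    by (simp add: hs_norm_sq_nonneg)
qed

lemma cp_prod_self_at_0:
  assumes "cp_star \<mu> \<nu> A = A" "A \<in> QHM c \<mu> \<nu>"
  shows "cp_prod \<mu> \<nu> A A x y 0 = of_real ((l2_norm (reg_col \<mu> \<nu> A x y))\<^sup>2)"
  by (simp add: cp_prod_at_0[OF assms(1)] l2_inner_self reg_col_in_l2[OF QHM_reg_bounded[OF assms(2)]])

text \<open>In each fibre, Cauchy-Schwarz and \<open>2ab <= a^2 + b^2\<close> give the majorant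
  \<open>?g\<close>. Integration turns it into half the sum of four squared norms, where those of
  \<open>AP\<close> and \<open>BP\<close> are at most those of \<open>A\<close> and
  \<open>B\<close>.\<close>

lemma cmod_tauD_commutator_le:
  assumes P: "QHM_projection \<mu> \<nu> P" "P \<in> QHM c \<mu> \<nu>"
    and A: "cp_star \<mu> \<nu> A = A" "A \<in> QHM c \<mu> \<nu>" and B: "cp_star \<mu> \<nu> B = B" "B \<in> QHM c \<mu> \<nu>"
  shows "cmod (tauD (cp_prod \<mu> \<nu> P (cp_prod \<mu> \<nu> A B - cp_prod \<mu> \<nu> B A)))
    \<le> hs_norm_sq \<mu> \<nu> A + hs_norm_sq \<mu> \<nu> B"
proof -
  let ?f = "\<lambda>m. cp_prod \<mu> \<nu> P (cp_prod \<mu> \<nu> A B - cp_prod \<mu> \<nu> B A) (fst m) (snd m) 0"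
  let ?N = "\<lambda>\<Phi> m. (l2_norm (reg_col \<mu> \<nu> \<Phi> (fst m) (snd m)))\<^sup>2"
  let ?g = "\<lambda>m. 1/2 * ((?N (cp_prod \<mu> \<nu> A P) m + ?N B m) + (?N (cp_prod \<mu> \<nu> B P) m + ?N A m))"
  note rb = QHM_reg_bounded[OF P(2)] QHM_reg_bounded[OF A(2)] QHM_reg_bounded[OF B(2)]
  note AP = hs_norm_sq_cp_prod_projection[OF P A]
  note BP = hs_norm_sq_cp_prod_projection[OF P B]
  note NA = QHM_l2_norm_reg_col_integral(1)[OF A(2)]
  note NB = QHM_l2_norm_reg_col_integral(1)[OF B(2)]
  have P1: "cp_star \<mu> \<nu> P = P" using P(1) by (simp add: QHM_projection_def)
  have l2: "reg_col \<mu> \<nu> (cp_prod \<mu> \<nu> A P) x y \<in> l2" "reg_col \<mu> \<nu> (cp_prod \<mu> \<nu> B P) x y \<in> l2" for x y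
    using reg_col_cp_prod_bound[OF rb(2,1)] reg_col_cp_prod_bound[OF rb(3,1)] by metis+
  have amgm: "cmod (l2_inner \<xi> \<eta>) \<le> 1/2 * ((l2_norm \<xi>)\<^sup>2 + (l2_norm \<eta>)\<^sup>2)" if "\<xi> \<in> l2" "\<eta> \<in> l2" for \<xi> \<eta>
  proof -
    have "2 * (l2_norm \<xi> * l2_norm \<eta>) \<le> (l2_norm \<xi>)\<^sup>2 + (l2_norm \<eta>)\<^sup>2"
      using sum_squares_bound[of "l2_norm \<xi>" "l2_norm \<eta>"] by (simp only: mult.assoc)
    then show ?thesis
      using cmod_l2_inner_le[OF that] by simp
  qed
  have le: "cmod (?f m) \<le> ?g m" for m
  proof -
    have "cmod (?f m) \<le> cmod (l2_inner (reg_col \<mu> \<nu> (cp_prod \<mu> \<nu> A P) (fst m) (snd m)) (reg_col \<mu> \<nu> B (fst m) (snd m)))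
        + cmod (l2_inner (reg_col \<mu> \<nu> (cp_prod \<mu> \<nu> B P) (fst m) (snd m)) (reg_col \<mu> \<nu> A (fst m) (snd m)))"
      unfolding cp_prod_commutator_at_0[OF P1 rb(1) A(1) rb(2) B(1) rb(3)] by (rule norm_triangle_ineq4)
    also have "\<dots> \<le> ?g m"
      unfolding distrib_left[of "1/2"] by (intro add_mono amgm[unfolded distrib_left] l2 reg_col_in_l2 rb)
    finally show ?thesis .
  qed
  have gi: "?g integrable_on unit_square"
    by (intro integrable_on_mult_right Henstock_Kurzweil_Integration.integrable_add AP(1) BP(1) NA NB)
  have "integral unit_square ?g = 1/2 * ((hs_norm_sq \<mu> \<nu> (cp_prod \<mu> \<nu> A P) + hs_norm_sq \<mu> \<nu> B)
      + (hs_norm_sq \<mu> \<nu> (cp_prod \<mu> \<nu> B P) + hs_norm_sq \<mu> \<nu> A))"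
    unfolding hs_norm_sq_def
    by (simp add: Henstock_Kurzweil_Integration.integral_add Henstock_Kurzweil_Integration.integrable_add AP(1) BP(1) NA NB)
  also have "\<dots> \<le> hs_norm_sq \<mu> \<nu> A + hs_norm_sq \<mu> \<nu> B"
    using AP(2) BP(2) by simp
  finally have G: "integral unit_square ?g \<le> hs_norm_sq \<mu> \<nu> A + hs_norm_sq \<mu> \<nu> B" .
  have "cmod (integral unit_square ?f) \<le> integral unit_square ?g"
  \<comment> \<open>Were \<open>?f\<close> not integrable, its integral would be 0 by convention,
    and the nonnegative majorant still dominates.\<close>
  proof (cases "?f integrable_on unit_square")
    case True
    then show ?thesis
      by (rule Henstock_Kurzweil_Integration.integral_norm_bound_integral[OF _ gi le])
  next
    case False
    have "0 \<le> ?g m" for m using le[of m] norm_ge_zero order_trans by blast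
    then show ?thesis
      by (simp only: not_integrable_integral[OF False] norm_zero)
        (intro Henstock_Kurzweil_Integration.integral_nonneg gi)
  qed
  with G show ?thesis
    by (simp add: tauD_def case_prod_unfold)
qed

lemma cmod_charge2_le:
  assumes "P \<in> QHM_smooth c \<mu> \<nu>" "QHM_projection \<mu> \<nu> P" "V \<in> {hX, hY, hZ}" "W \<in> {hX, hY, hZ}"
  shows "cmod (charge2 c \<mu> \<nu> V W P) \<le> hs_norm_sq \<mu> \<nu> (delta c \<mu> V P) + hs_norm_sq \<mu> \<nu> (delta c \<mu> W P)"
proof -
  have P: "P \<in> QHM c \<mu> \<nu>" "cp_star \<mu> \<nu> P = P"
    using assms(1,2) by (auto simp: QHM_smooth_def QHM_projection_def)
  note V = delta_QHM[OF assms(1) P(2) assms(3)] and W = delta_QHM[OF assms(1) P(2) assms(4)]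
  let ?t = "cmod (tauD (cp_prod \<mu> \<nu> P (cp_prod \<mu> \<nu> (delta c \<mu> V P) (delta c \<mu> W P)
     - cp_prod \<mu> \<nu> (delta c \<mu> W P) (delta c \<mu> V P))))"
  have "cmod (charge2 c \<mu> \<nu> V W P) = ?t / (2 * pi)"
    by (simp add: charge2_def norm_divide norm_mult)
  \<comment> \<open>The factor \<open>1 / (2 * pi)\<close> is estimated by 1, which already suffices
    for the claim.\<close>
  also have "\<dots> \<le> ?t / 1"
    using pi_gt3 by (intro divide_left_mono) auto
  also have "\<dots> \<le> hs_norm_sq \<mu> \<nu> (delta c \<mu> V P) + hs_norm_sq \<mu> \<nu> (delta c \<mu> W P)"
    using cmod_tauD_commutator_le[OF assms(2) P(1) V(2,1) W(2,1)] by simp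
  finally show ?thesis .
qed

text \<open>The derivatives are self-adjoint, so coefficient 0 of each square is a squared column
  norm. In particular the action is real.\<close>

lemma action_S_eq:
  assumes "P \<in> QHM_smooth c \<mu> \<nu>" "cp_star \<mu> \<nu> P = P"
  shows "action_S c \<mu> \<nu> P = of_real (2 * (hs_norm_sq \<mu> \<nu> (delta c \<mu> hX P)
    + hs_norm_sq \<mu> \<nu> (delta c \<mu> hY P) + hs_norm_sq \<mu> \<nu> (delta c \<mu> hZ P)))"
proof -
  let ?N = "\<lambda>V m. (l2_norm (reg_col \<mu> \<nu> (delta c \<mu> V P) (fst m) (snd m)))\<^sup>2"
  note D = delta_QHM[OF assms]
  have i: "?N V integrable_on unit_square" if "V \<in> {hX, hY, hZ}" for V
    by (rule QHM_l2_norm_reg_col_integral(1)[OF D(1)[OF that]])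
  have "action_S c \<mu> \<nu> P
      = 2 * integral unit_square (complex_of_real \<circ> (\<lambda>m. ?N hX m + ?N hY m + ?N hZ m))"
    by (simp add: action_S_def tauD_def case_prod_unfold o_def cp_prod_self_at_0[OF D(2,1)])
  also have "\<dots> = 2 * of_real (integral unit_square (\<lambda>m. ?N hX m + ?N hY m + ?N hZ m))"
    by (subst integral_linear) (auto intro!: Henstock_Kurzweil_Integration.integrable_add i bounded_linear_of_real)
  also have "integral unit_square (\<lambda>m. ?N hX m + ?N hY m + ?N hZ m) = hs_norm_sq \<mu> \<nu> (delta c \<mu> hX P)
    + hs_norm_sq \<mu> \<nu> (delta c \<mu> hY P) + hs_norm_sq \<mu> \<nu> (delta c \<mu> hZ P)"
    unfolding hs_norm_sq_def
    by (simp add: Henstock_Kurzweil_Integration.integral_add Henstock_Kurzweil_Integration.integrable_add i)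
  finally show ?thesis by simp
qed

theorem lemma4p2:
  fixes c :: nat and \<mu> \<nu> :: real and P :: cfun
  assumes "c > 0"
    and "P \<in> QHM_smooth c \<mu> \<nu>"
    and "QHM_projection \<mu> \<nu> P"
  shows "action_S c \<mu> \<nu> P \<in> \<real> \<and>
    Re (action_S c \<mu> \<nu> P)
      \<ge> cmod (charge2 c \<mu> \<nu> hX hY P) + cmod (charge2 c \<mu> \<nu> hY hZ P) + cmod (charge2 c \<mu> \<nu> hX hZ P) \<and>
    cmod (charge2 c \<mu> \<nu> hX hY P) + cmod (charge2 c \<mu> \<nu> hY hZ P) + cmod (charge2 c \<mu> \<nu> hX hZ P)
      \<ge> cmod (top_charge c \<mu> \<nu> P)"
proof (intro conjI)
  have star: "cp_star \<mu> \<nu> P = P"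
    using assms(3) by (simp add: QHM_projection_def)
  note S = action_S_eq[OF assms(2) star]
  show "action_S c \<mu> \<nu> P \<in> \<real>"
    unfolding S by (rule Reals_of_real)
  show "Re (action_S c \<mu> \<nu> P)
      \<ge> cmod (charge2 c \<mu> \<nu> hX hY P) + cmod (charge2 c \<mu> \<nu> hY hZ P) + cmod (charge2 c \<mu> \<nu> hX hZ P)"
    \<comment> \<open>Each of the three derivatives occurs in exactly two of the three pairs, which
      accounts for the factor 2 in the action.\<close>
    unfolding S
    using cmod_charge2_le[OF assms(2,3), of hX hY] cmod_charge2_le[OF assms(2,3), of hY hZ]
      cmod_charge2_le[OF assms(2,3), of hX hZ] by simp
  show "cmod (charge2 c \<mu> \<nu> hX hY P) + cmod (charge2 c \<mu> \<nu> hY hZ P) + cmod (charge2 c \<mu> \<nu> hX hZ P)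
      \<ge> cmod (top_charge c \<mu> \<nu> P)"
    unfolding top_charge_def
    using norm_triangle_ineq[of "charge2 c \<mu> \<nu> hX hY P + charge2 c \<mu> \<nu> hX hZ P" "charge2 c \<mu> \<nu> hY hZ P"]
      norm_triangle_ineq[of "charge2 c \<mu> \<nu> hX hY P" "charge2 c \<mu> \<nu> hX hZ P"] by linarith
qed

end
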